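(* Under the setting of $\min f(x)$ s.t. $g(x)\in K$ ($f,g$ twice continuously differentiable, $K$ closed, $C:=g^{-1}(K)$), let $d\in T_C(\bar x)$, let $\bar x$ be a local optimal solution in direction $d$, suppose $\nabla f(\bar x)d=0$ and MSCQ holds at $\bar x$ in direction $d$ for $g(x)\in K$. Then: (i) there exists $\lambda\in\Lambda(\bar x;d)$ such that $\hat\sigma_{T_K^{''}(g(\bar x);\nabla g(\bar x)d),A}(\lambda)\le0$ for every set $A\supseteq\Theta$; in particular $\hat\sigma_{T_K^{''}(g(\bar x);\nabla g(\bar x)d)}(\lambda)\le0$; (ii) if $T_K^2(g(\bar x);\nabla g(\bar x)d)\ne\emptyset$, there exists $\lambda\in\Lambda(\bar x;d)$ such that for every set $B\supseteq\Omega$, $\nabla^2_{xx}L(\bar x,\lambda)(d,d)-\hat\sigma_{T_K^2(g(\bar x);\nabla g(\bar x)d),B}(\lambda)\ge0$; in particular $\nabla^2_{xx}L(\bar x,\lambda)(d,d)-\hat\sigma_{T_K^2(g(\bar x);\nabla g(\bar x)d)}(\lambda)\ge0$.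
   Context: Lower generalized support function: for closed $S\subseteq\mathbb{R}^m$ and $A\subseteq\mathbb{R}^m$, if $S\ne\emptyset$, $\hat\sigma_{S,A}(\lambda):=\liminf_{\lambda'\to\lambda}\inf_u\{\langle\lambda',u\rangle\mid u\in A,\ \lambda'\in N_S(u)\}$ ($\inf\emptyset=+\infty$, $N_S$ limiting normal cone); if $S=\emptyset$, $\hat\sigma_{S,A}\equiv-\infty$; $\hat\sigma_S:=\hat\sigma_{S,\mathbb{R}^m}$. $L(x,\lambda):=f(x)+\langle\lambda,g(x)\rangle$; $\Lambda(\bar x;d):=\{\lambda\mid\lambda\in N_K(g(\bar x);\nabla g(\bar x)d),\ \nabla_xL(\bar x,\lambda)=0\}$ with directional limiting normal cone $N_K(\bar y;v):=\limsup_{t\downarrow0,v'\to v}\hat N_K(\bar y+tv')$. $\Theta:=\nabla g(\bar x)(T_C^{''}(\bar x;d))$, $\Omega:=\nabla g(\bar x)(T_C^2(\bar x;d))+\nabla^2g(\bar x)(d,d)$. $T_S^2(\bar y;v):=\{w\mid \exists t_k\downarrow0,w_k\to w,\ \bar y+t_kv+\tfrac12t_k^2w_k\in S\}$; $T_S^{''}(\bar y;v):=\{w\mid \exists(t_k,r_k)\downarrow(0,0),w_k\to w,\ t_k/r_k\to0,\ \bar y+t_kv+\tfrac12t_kr_kw_k\in S\}$. Local optimality in direction $d$: $f(x)\ge f(\bar x)$ on $C\cap(\bar x+V_{\rho,\delta}(d))$ for some $\rho,\delta>0$, $V_{\rho,\delta}(d):=\{w\in\delta B\mid\|\,\|d\|w-\|w\|d\,\|\le\rho\|w\|\|d\|\}$.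 MSCQ in direction $d$: $\mathrm{dist}(x,g^{-1}(K))\le\kappa\,\mathrm{dist}(g(x),K)$ on $\bar x+V_{\rho,\delta}(d)$ for some $\rho,\delta,\kappa>0$. *)

theory Defs
  imports "HOL-Analysis.Analysis"
begin

definition D1 :: "('a::real_normed_vector \<Rightarrow> 'b::real_normed_vector) \<Rightarrow> 'a \<Rightarrow> 'a \<Rightarrow> 'b" where
  "D1 g x = frechet_derivative g (at x)"

definition D2 :: "('a::real_normed_vector \<Rightarrow> 'b::real_normed_vector) \<Rightarrow> 'a \<Rightarrow> 'a \<Rightarrow> 'a \<Rightarrow> 'b" where
  "D2 g x v w = frechet_derivative (\<lambda>y. D1 g y w) (at x) v"

definition C2 :: "('a::euclidean_space \<Rightarrow> 'b::real_normed_vector) \<Rightarrow> bool" where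
  "C2 g \<longleftrightarrow> (\<forall>x. g differentiable (at x)) \<and>
            (\<forall>w x. (\<lambda>y. D1 g y w) differentiable (at x)) \<and>
            (\<forall>v w. continuous_on UNIV (\<lambda>x. D2 g x v w))"

definition rnormal :: "'a::euclidean_space set \<Rightarrow> 'a \<Rightarrow> 'a set" where
  "rnormal S y = {v. y \<in> S \<and> (\<forall>e>0. \<exists>r>0. \<forall>y'\<in>S. dist y' y < r \<longrightarrow> v \<bullet> (y' - y) \<le> e * norm (y' - y))}"

definition lnormal :: "'a::euclidean_space set \<Rightarrow> 'a \<Rightarrow> 'a set" where
  "lnormal S y = {v. \<exists>yk vk. yk \<longlonglongrightarrow> y \<and> vk \<longlonglongrightarrow> v \<and> (\<forall>k. vk k \<in> rnormal S (yk k))}"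

definition dnormal :: "'a::euclidean_space set \<Rightarrow> 'a \<Rightarrow> 'a \<Rightarrow> 'a set" where
  "dnormal S y u = {v. \<exists>t uk vk. (\<forall>k. t k > 0) \<and> t \<longlonglongrightarrow> 0 \<and> uk \<longlonglongrightarrow> u \<and> vk \<longlonglongrightarrow> v \<and>
      (\<forall>k. vk k \<in> rnormal S (y + t k *\<^sub>R uk k))}"

definition tcone :: "'a::euclidean_space set \<Rightarrow> 'a \<Rightarrow> 'a set" where
  "tcone S y = {u. \<exists>t uk. (\<forall>k. t k > 0) \<and> t \<longlonglongrightarrow> 0 \<and> uk \<longlonglongrightarrow> u \<and>
      (\<forall>k. y + t k *\<^sub>R uk k \<in> S)}"

definition tset2 :: "'a::euclidean_space set \<Rightarrow> 'a \<Rightarrow> 'a \<Rightarrow> 'a set" where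
  "tset2 S y v = {w. \<exists>t wk. (\<forall>k. t k > 0) \<and> t \<longlonglongrightarrow> 0 \<and> wk \<longlonglongrightarrow> w \<and>
      (\<forall>k. y + t k *\<^sub>R v + ((1/2) * (t k)\<^sup>2) *\<^sub>R wk k \<in> S)}"

definition tset2a :: "'a::euclidean_space set \<Rightarrow> 'a \<Rightarrow> 'a \<Rightarrow> 'a set" where
  "tset2a S y v = {w. \<exists>t r wk. (\<forall>k. t k > 0 \<and> r k > 0) \<and> t \<longlonglongrightarrow> 0 \<and> r \<longlonglongrightarrow> 0 \<and>
      (\<lambda>k. t k / r k) \<longlonglongrightarrow> 0 \<and> wk \<longlonglongrightarrow> w \<and>
      (\<forall>k. y + t k *\<^sub>R v + ((1/2) * t k * r k) *\<^sub>R wk k \<in> S)}"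

definition lgsupp :: "'a::euclidean_space set \<Rightarrow> 'a set \<Rightarrow> 'a \<Rightarrow> ereal" where
  "lgsupp S A l = (if S = {} then -\<infinity>
     else Liminf (nhds l) (\<lambda>l'. INF u\<in>{u\<in>A. l' \<in> lnormal S u}. ereal (l' \<bullet> u)))"

definition Vdir :: "real \<Rightarrow> real \<Rightarrow> 'a::euclidean_space \<Rightarrow> 'a set" where
  "Vdir \<rho> \<delta> d = {w \<in> cball 0 \<delta>. norm (norm d *\<^sub>R w - norm w *\<^sub>R d) \<le> \<rho> * norm w * norm d}"

definition lagr :: "('a \<Rightarrow> real) \<Rightarrow> ('a \<Rightarrow> 'b::real_inner) \<Rightarrow> 'b \<Rightarrow> 'a \<Rightarrow> real" where
  "lagr f g l x = f x + l \<bullet> g x"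

definition Mult :: "('a::euclidean_space \<Rightarrow> real) \<Rightarrow> ('a \<Rightarrow> 'b::euclidean_space) \<Rightarrow> 'b set \<Rightarrow> 'a \<Rightarrow> 'a \<Rightarrow> 'b set" where
  "Mult f g K xb d = {l. l \<in> dnormal K (g xb) (D1 g xb d) \<and> D1 (lagr f g l) xb = (\<lambda>h. 0)}"

definition loc_opt_dir :: "('a::euclidean_space \<Rightarrow> real) \<Rightarrow> 'a set \<Rightarrow> 'a \<Rightarrow> 'a \<Rightarrow> bool" where
  "loc_opt_dir f C xb d \<longleftrightarrow> (\<exists>\<rho>>0. \<exists>\<delta>>0. \<forall>x\<in>C. x - xb \<in> Vdir \<rho> \<delta> d \<longrightarrow> f x \<ge> f xb)"

definition MSCQ_dir :: "('a::euclidean_space \<Rightarrow> 'b::euclidean_space) \<Rightarrow> 'b set \<Rightarrow> 'a \<Rightarrow> 'a \<Rightarrow> bool" where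
  "MSCQ_dir g K xb d \<longleftrightarrow> (\<exists>\<rho>>0. \<exists>\<delta>>0. \<exists>\<kappa>>0. \<forall>x. x - xb \<in> Vdir \<rho> \<delta> d \<longrightarrow>
      infdist x (g -` K) \<le> \<kappa> * infdist (g x) K)"

end

theory Submission
  imports Defs
begin

text \<open>
  Both second-order tangent sets are the cases \<open>\<tau> = 0\<close> and \<open>\<tau> = 1\<close> of a set of limits of
  \<open>(S - y - t v) / (t r / 2)\<close> with \<open>t / r\<close> tending to \<open>\<tau>\<close>, and one argument treats both.
  Write \<open>T\<close> for this set at \<open>K\<close> and \<open>W\<close> for the one at \<open>C = g -` K\<close>. A second-order
  expansion of \<open>g\<close> and MSCQ give \<open>W = {w. G w + b \<in> T}\<close> with \<open>G\<close> the derivative of \<open>g\<close> and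
  \<open>b = \<tau> D\<^sup>2g(d,d)\<close>, together with \<open>dist (w, W) \<le> \<kappa> dist (G w + b, T)\<close>; optimality makes
  \<open>Df w + \<tau> D\<^sup>2f(d,d)\<close> nonnegative on \<open>W\<close>. Minimise \<open>Df w + (\<epsilon>/2) |w|\<^sup>2\<close> over \<open>W\<close>, and
  replace the constraint by the penalty \<open>(i/2) |G w + b - u|\<^sup>2\<close> with \<open>u \<in> T\<close>. The vectors
  \<open>i (G w + b - u)\<close> are proximal normals to \<open>T\<close>, hence directional limiting normals to \<open>K\<close>, and
  stay bounded by the error bound. Letting \<open>i\<close> tend to infinity and then \<open>\<epsilon>\<close> to \<open>0\<close> gives
  the multiplier.
\<close>

subsection \<open>Minimisers, nearest points and directional normals\<close>

text \<open>The feasible sets below need not be bounded, so compactness comes from the sublevel set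
  of one feasible point; points outside it cannot lower the value.\<close>

lemma continuous_attains_inf_bounded_sublevel:
  fixes F :: "'a::heine_borel \<Rightarrow> real"
  assumes "closed X" "continuous_on UNIV F" "x0 \<in> X" "bounded {x \<in> X. F x \<le> F x0}"
  obtains x where "x \<in> X" "\<And>y. y \<in> X \<Longrightarrow> F x \<le> F y"
proof -
  let ?S = "{x \<in> X. F x \<le> F x0}"
  have "?S = X \<inter> {x. F x \<le> F x0}" by auto
  moreover have "closed {x. F x \<le> F x0}"
    by (intro closed_Collect_le assms continuous_on_const)
  ultimately have "compact ?S" using assms by (auto simp: compact_eq_bounded_closed)
  moreover have "?S \<noteq> {}" using assms by auto
  moreover have "continuous_on ?S F" using assms(2) by (rule continuous_on_subset) auto
  ultimately obtain x where "x \<in> ?S" "\<And>y. y \<in> ?S \<Longrightarrow> F x \<le> F y"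
    using continuous_attains_inf by meson
  then have "x \<in> X" "F x \<le> F y" if "y \<in> X" for y
    using that by (cases "F y \<le> F x0", fastforce+)
  then show ?thesis using that \<open>x \<in> ?S\<close> by blast
qed

lemma bounded_convergent_subseq:
  fixes x :: "nat \<Rightarrow> 'a::heine_borel"
  assumes "bounded (range x)"
  obtains l and s :: "nat \<Rightarrow> nat" where "strict_mono s" "(x \<circ> s) \<longlonglongrightarrow> l"
  using assms bounded_imp_convergent_subsequence by metis

text \<open>Comparing squared distances bounds \<open>(q - p) \<bullet> (y - p)\<close> by
  \<open>(norm (y - p))\<^sup>2\<close>, which is of smaller order than
  \<open>norm (y - p)\<close>.\<close>

lemma nearest_point_rnormal:
  fixes K :: "'a::euclidean_space set"
  assumes "p \<in> K" "\<And>y. y \<in> K \<Longrightarrow> norm (q - p) \<le> norm (q - y)" "\<alpha> \<ge> 0"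
  shows "\<alpha> *\<^sub>R (q - p) \<in> rnormal K p"
proof -
  have *: "\<alpha> * ((q - p) \<bullet> (y - p)) \<le> \<alpha> * (norm (y - p))\<^sup>2" if "y \<in> K" for y
  proof -
    have "(norm (q - p))\<^sup>2 \<le> (norm (q - y))\<^sup>2"
      using assms(2)[OF that] by (simp add: power_mono)
    also have "q - y = (q - p) - (y - p)" by simp
    also have "(norm ((q - p) - (y - p)))\<^sup>2 = (norm (q - p))\<^sup>2 - 2 * ((q - p) \<bullet> (y - p)) + (norm (y - p))\<^sup>2"
      by (simp only: power2_norm_eq_inner inner_diff_left inner_diff_right inner_commute) (simp add: inner_commute)
    finally have "2 * ((q - p) \<bullet> (y - p)) \<le> (norm (y - p))\<^sup>2" by simp
    then have "(q - p) \<bullet> (y - p) \<le> (norm (y - p))\<^sup>2" using zero_le_power2[of "norm (y - p)"] by linarith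
    then show ?thesis using assms(3) by (simp add: mult_left_mono)
  qed
  show ?thesis unfolding rnormal_def
  proof (intro CollectI conjI allI impI)
    fix e :: real assume "e > 0"
    show "\<exists>r>0. \<forall>y'\<in>K. dist y' p < r \<longrightarrow> (\<alpha> *\<^sub>R (q - p)) \<bullet> (y' - p) \<le> e * norm (y' - p)"
    \<comment> \<open>Within this radius \<open>\<alpha> * norm (y' - p)\<close> is at most
      \<open>e\<close>; the summand 1 covers \<alpha> = 0.\<close>
    proof (intro exI[of _ "e / (\<alpha> + 1)"] conjI ballI impI)
      show "e / (\<alpha> + 1) > 0" using \<open>e > 0\<close> assms(3) by auto
      fix y' assume y: "y' \<in> K" "dist y' p < e / (\<alpha> + 1)"
      then have "\<alpha> * norm (y' - p) \<le> (\<alpha> + 1) * norm (y' - p)"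
        by (simp add: mult_right_mono)
      also have "\<dots> \<le> e"
        using y(2) assms(3) by (simp add: dist_norm field_simps)
      finally have "\<alpha> * norm (y' - p) * norm (y' - p) \<le> e * norm (y' - p)"
        by (rule mult_right_mono) simp
      then show "(\<alpha> *\<^sub>R (q - p)) \<bullet> (y' - p) \<le> e * norm (y' - p)"
        using *[OF y(1)] by (simp add: power2_eq_square mult.assoc)
    qed
  qed (use assms in auto)
qed

section \<open>Closedness of the directional limiting normal cone\<close>

lemma dnormal_approx:
  assumes "v \<in> dnormal S y u" "e > 0"
  shows "\<exists>t u' v'. 0 < t \<and> t < e \<and> dist u' u < e \<and> dist v' v < e \<and> v' \<in> rnormal S (y + t *\<^sub>R u')"
proof -
  obtain t uk vk where *: "\<And>k. t k > 0" "t \<longlonglongrightarrow> 0" "uk \<longlonglongrightarrow> u" "vk \<longlonglongrightarrow> v"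
    "\<And>k. vk k \<in> rnormal S (y + t k *\<^sub>R uk k)"
    using assms(1) unfolding dnormal_def by blast
  have "\<forall>\<^sub>F k in sequentially. t k < e \<and> dist (uk k) u < e \<and> dist (vk k) v < e"
    using order_tendstoD(2)[OF *(2) assms(2)] tendstoD[OF *(3) assms(2)] tendstoD[OF *(4) assms(2)]
    by eventually_elim auto
  then obtain k where "t k < e \<and> dist (uk k) u < e \<and> dist (vk k) v < e"
    using eventually_happens'[OF sequentially_bot] by blast
  then show ?thesis using *(1,5)[of k]
    by (intro exI[of _ "t k"] exI[of _ "uk k"] exI[of _ "vk k"]) simp
qed

lemma LIMSEQ_dist_inverse_Suc:
  assumes "x \<longlonglongrightarrow> l" "\<And>n. dist (y n) (x n) < inverse (real (Suc n))"
  shows "y \<longlonglongrightarrow> l"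
proof -
  have "(\<lambda>n. dist (y n) (x n)) \<longlonglongrightarrow> 0"
    by (rule real_tendsto_sandwich[OF _ _ tendsto_const LIMSEQ_inverse_real_of_nat])
       (use assms(2) in \<open>auto intro!: always_eventually less_imp_le simp del: of_nat_Suc\<close>)
  from tendsto_add[OF this iffD1[OF tendsto_dist_iff assms(1)]]
  have lim: "(\<lambda>n. dist (y n) (x n) + dist (x n) l) \<longlonglongrightarrow> 0" by simp
  have "(\<lambda>n. dist (y n) l) \<longlonglongrightarrow> 0"
    by (rule real_tendsto_sandwich[OF _ _ tendsto_const lim])
       (auto intro!: always_eventually dist_triangle)
  then show ?thesis by (rule iffD2[OF tendsto_dist_iff])
qed

text \<open>Diagonal argument: near the n-th vector choose a regular normal with scale, direction
  and vector all within 1/(n+1) of their targets; these choices form one defining sequence for the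
  limit.\<close>

lemma closed_dnormal: "closed (dnormal S y u)"
proof (unfold closed_sequential_limits, intro allI impI, elim conjE)
  fix x l assume x: "\<forall>n. x n \<in> dnormal S y u" "x \<longlonglongrightarrow> l"
  have "\<forall>n. \<exists>t u' v'. 0 < t \<and> t < inverse (real (Suc n)) \<and> dist u' u < inverse (real (Suc n))
      \<and> dist v' (x n) < inverse (real (Suc n)) \<and> v' \<in> rnormal S (y + t *\<^sub>R u')"
    using dnormal_approx x(1) by (metis inverse_positive_iff_positive of_nat_0_less_iff zero_less_Suc)
  then obtain t u' v' where *: "\<And>n. 0 < t n" "\<And>n. t n < inverse (real (Suc n))"
    "\<And>n. dist (u' n) u < inverse (real (Suc n))" "\<And>n. dist (v' n) (x n) < inverse (real (Suc n))"
    "\<And>n. v' n \<in> rnormal S (y + t n *\<^sub>R u' n)" by metis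
  have "t \<longlonglongrightarrow> 0" using *(1,2) by (intro LIMSEQ_dist_inverse_Suc[OF tendsto_const]) (auto simp: dist_norm less_imp_le abs_of_pos)
  moreover have "u' \<longlonglongrightarrow> u" by (rule LIMSEQ_dist_inverse_Suc[OF tendsto_const *(3)])
  moreover have "v' \<longlonglongrightarrow> l" by (rule LIMSEQ_dist_inverse_Suc[OF x(2) *(4)])
  ultimately show "l \<in> dnormal S y u" unfolding dnormal_def using *(1,5)
    by (intro CollectI exI[of _ t] exI[of _ u'] exI[of _ v']) simp
qed

subsection \<open>Tangent sets with prescribed ratio\<close>

definition tset_ratio :: "real \<Rightarrow> 'a::euclidean_space set \<Rightarrow> 'a \<Rightarrow> 'a \<Rightarrow> 'a set" where
  "tset_ratio \<tau> S y v = {w. \<exists>t r wk. (\<forall>k. t k > 0 \<and> r k > 0) \<and> t \<longlonglongrightarrow> 0 \<and> r \<longlonglongrightarrow> 0 \<and>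
      (\<lambda>k. t k / r k) \<longlonglongrightarrow> \<tau> \<and> wk \<longlonglongrightarrow> w \<and>
      (\<forall>k. y + t k *\<^sub>R v + ((1/2) * t k * r k) *\<^sub>R wk k \<in> S)}"

lemma tset_ratioI:
  fixes t r :: "nat \<Rightarrow> real" and wk :: "nat \<Rightarrow> 'a::euclidean_space"
  assumes "\<And>k. t k > 0" "\<And>k. r k > 0" "t \<longlonglongrightarrow> 0" "r \<longlonglongrightarrow> 0" "(\<lambda>k. t k / r k) \<longlonglongrightarrow> \<tau>" "wk \<longlonglongrightarrow> w"
    and "\<forall>\<^sub>F k in sequentially. y + t k *\<^sub>R v + ((1/2) * t k * r k) *\<^sub>R wk k \<in> S"
  shows "w \<in> tset_ratio \<tau> S y v"
proof -
  obtain N where N: "\<And>k. k \<ge> N \<Longrightarrow> y + t k *\<^sub>R v + ((1/2) * t k * r k) *\<^sub>R wk k \<in> S"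
    using assms(7) by (auto simp: eventually_sequentially)
  show ?thesis unfolding tset_ratio_def
    using assms(1,2) N
      LIMSEQ_ignore_initial_segment[OF assms(3), of N] LIMSEQ_ignore_initial_segment[OF assms(4), of N]
      LIMSEQ_ignore_initial_segment[OF assms(5), of N] LIMSEQ_ignore_initial_segment[OF assms(6), of N]
    by (intro CollectI exI[of _ "\<lambda>k. t (k + N)"] exI[of _ "\<lambda>k. r (k + N)"] exI[of _ "\<lambda>k. wk (k + N)"]) auto
qed

lemma tset_ratioE:
  assumes "w \<in> tset_ratio \<tau> S y v"
  obtains t r :: "nat \<Rightarrow> real" and wk where
    "\<And>k. t k > 0" "\<And>k. r k > 0" "t \<longlonglongrightarrow> 0" "r \<longlonglongrightarrow> 0" "(\<lambda>k. t k / r k) \<longlonglongrightarrow> \<tau>" "wk \<longlonglongrightarrow> w"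
    "\<And>k. y + t k *\<^sub>R v + ((1/2) * t k * r k) *\<^sub>R wk k \<in> S"
  using assms unfolding tset_ratio_def by blast

lemma tset2a_eq_tset_ratio: "tset2a S y v = tset_ratio 0 S y v"
  unfolding tset2a_def tset_ratio_def ..

text \<open>\<open>tset2\<close> takes \<open>t = r\<close>, whereas ratio 1 only asks
  \<open>t / r\<close> to tend to 1. The factor \<open>r / t\<close> is absorbed into
  \<open>wk\<close>, whose limit it does not change.\<close>

lemma tset2_eq_tset_ratio: "tset2 S y v = tset_ratio 1 S y v"
proof (intro equalityI subsetI)
  fix w assume "w \<in> tset2 S y v"
  then obtain t wk where *: "\<And>k. t k > 0" "t \<longlonglongrightarrow> 0" "wk \<longlonglongrightarrow> w"
      "\<And>k. y + t k *\<^sub>R v + ((1/2) * (t k)\<^sup>2) *\<^sub>R wk k \<in> S"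
    unfolding tset2_def by blast
  have "(\<lambda>k. t k / t k) = (\<lambda>k. 1)" using *(1) by (auto simp: less_imp_neq[symmetric])
  then show "w \<in> tset_ratio 1 S y v"
    using * by (intro tset_ratioI[of t t _ wk]) (auto simp: power2_eq_square mult.assoc)
next
  fix w assume "w \<in> tset_ratio 1 S y v"
  then obtain t r wk where *: "\<And>k. t k > 0" "\<And>k. r k > 0" "t \<longlonglongrightarrow> 0" "r \<longlonglongrightarrow> 0" "(\<lambda>k. t k / r k) \<longlonglongrightarrow> 1" "wk \<longlonglongrightarrow> w"
    "\<And>k. y + t k *\<^sub>R v + ((1/2) * t k * r k) *\<^sub>R wk k \<in> S" by (rule tset_ratioE) blast
  have "(\<lambda>k. inverse (t k / r k) *\<^sub>R wk k) \<longlonglongrightarrow> inverse 1 *\<^sub>R w"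
    by (intro tendsto_intros *) auto
  then have "(\<lambda>k. (r k / t k) *\<^sub>R wk k) \<longlonglongrightarrow> w" by simp
  moreover have "((1/2) * (t k)\<^sup>2) *\<^sub>R ((r k / t k) *\<^sub>R wk k) = ((1/2) * t k * r k) *\<^sub>R wk k" for k
    using *(1)[of k] by (simp add: power2_eq_square)
  then have "y + t k *\<^sub>R v + ((1/2) * (t k)\<^sup>2) *\<^sub>R ((r k / t k) *\<^sub>R wk k) \<in> S" for k
    using *(7)[of k] by metis
  ultimately show "w \<in> tset2 S y v" unfolding tset2_def using *(1,3) by blast
qed

lemma tset_ratio_approx:
  assumes "w \<in> tset_ratio \<tau> S y v" "e > 0"
  shows "\<exists>t r w'. 0 < t \<and> t < e \<and> 0 < r \<and> r < e \<and> dist (t / r) \<tau> < e \<and> dist w' w < e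
    \<and> y + t *\<^sub>R v + ((1/2) * t * r) *\<^sub>R w' \<in> S"
proof -
  obtain t r wk where *: "\<And>k. t k > 0" "\<And>k. r k > 0" "t \<longlonglongrightarrow> 0" "r \<longlonglongrightarrow> 0" "(\<lambda>k. t k / r k) \<longlonglongrightarrow> \<tau>" "wk \<longlonglongrightarrow> w"
    "\<And>k. y + t k *\<^sub>R v + ((1/2) * t k * r k) *\<^sub>R wk k \<in> S" using assms(1) by (rule tset_ratioE) blast
  have "\<forall>\<^sub>F k in sequentially. t k < e \<and> r k < e \<and> dist (t k / r k) \<tau> < e \<and> dist (wk k) w < e"
    using order_tendstoD(2)[OF *(3) assms(2)] order_tendstoD(2)[OF *(4) assms(2)]
      tendstoD[OF *(5) assms(2)] tendstoD[OF *(6) assms(2)]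
    by eventually_elim auto
  then obtain k where "t k < e \<and> r k < e \<and> dist (t k / r k) \<tau> < e \<and> dist (wk k) w < e"
    using eventually_happens'[OF sequentially_bot] by blast
  then show ?thesis using *(1,2,7)[of k]
    by (intro exI[of _ "t k"] exI[of _ "r k"] exI[of _ "wk k"]) simp
qed

lemma closed_tset_ratio: "closed (tset_ratio \<tau> S y v)"
proof (unfold closed_sequential_limits, intro allI impI, elim conjE)
  fix x l assume x: "\<forall>n. x n \<in> tset_ratio \<tau> S y v" "x \<longlonglongrightarrow> l"
  let ?i = "\<lambda>n. inverse (real (Suc n))"
  have "\<forall>n. \<exists>t r w'. 0 < t \<and> t < ?i n \<and> 0 < r \<and> r < ?i n \<and> dist (t / r) \<tau> < ?i n \<and> dist w' (x n) < ?i n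
    \<and> y + t *\<^sub>R v + ((1/2) * t * r) *\<^sub>R w' \<in> S"
    using x(1) by (intro allI tset_ratio_approx) auto
  then obtain t r w' where *: "\<And>n. 0 < t n" "\<And>n. t n < ?i n" "\<And>n. 0 < r n" "\<And>n. r n < ?i n"
     "\<And>n. dist (t n / r n) \<tau> < ?i n" "\<And>n. dist (w' n) (x n) < ?i n"
     "\<And>n. y + t n *\<^sub>R v + ((1/2) * t n * r n) *\<^sub>R w' n \<in> S" by metis
  have "t \<longlonglongrightarrow> 0" "r \<longlonglongrightarrow> 0"
    using *(1-4) by (auto intro!: LIMSEQ_dist_inverse_Suc[OF tendsto_const] simp: dist_norm less_imp_le abs_of_pos)
  moreover have "(\<lambda>n. t n / r n) \<longlonglongrightarrow> \<tau>" by (rule LIMSEQ_dist_inverse_Suc[OF tendsto_const *(5)])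
  moreover have "w' \<longlonglongrightarrow> l" by (rule LIMSEQ_dist_inverse_Suc[OF x(2) *(6)])
  ultimately show "l \<in> tset_ratio \<tau> S y v" using * by (intro tset_ratioI) auto
qed

text \<open>Supplies the nonemptiness that part (i) does not assume: for a tangent sequence
  \<open>u\<close> the remainder \<open>t (u - d)\<close> is negligible against \<open>t * r\<close>
  once \<open>r\<close> decays slowly enough.\<close>

lemma zero_in_tset_ratio_0:
  assumes "d \<in> tcone S y"
  shows "0 \<in> tset_ratio 0 S y d"
proof -
  obtain t u where *: "\<And>k. t k > 0" "t \<longlonglongrightarrow> 0" "u \<longlonglongrightarrow> d" "\<And>k. y + t k *\<^sub>R u k \<in> S"
    using assms unfolding tcone_def by blast
  \<comment> \<open>With square roots, \<open>t / r\<close> and \<open>norm (u - d) / r\<close> are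
    at most \<open>sqrt t\<close> and \<open>sqrt (norm (u - d))\<close>, so both vanish; the second
    summand keeps \<open>r\<close> positive when \<open>u k = d\<close>.\<close>
  define r where "r k = sqrt (norm (u k - d)) + sqrt (t k)" for k
  have r: "r k > 0" for k using *(1)[of k] by (auto simp: r_def intro!: add_nonneg_pos)
  have n0: "(\<lambda>k. sqrt (norm (u k - d))) \<longlonglongrightarrow> 0"
    using *(3) by (metis LIM_zero real_sqrt_zero tendsto_norm_zero tendsto_real_sqrt)
  have t0: "(\<lambda>k. sqrt (t k)) \<longlonglongrightarrow> 0"
    using *(2) by (metis real_sqrt_zero tendsto_real_sqrt)
  have r0: "r \<longlonglongrightarrow> 0" unfolding r_def using tendsto_add[OF n0 t0] by simp
  have "t k \<le> sqrt (t k) * r k" "norm (u k - d) \<le> sqrt (norm (u k - d)) * r k" for k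
    using *(1)[of k] by (auto simp: r_def distrib_left)
  then have le: "t k / r k \<le> sqrt (t k)" "norm (u k - d) / r k \<le> sqrt (norm (u k - d))" for k
    using r[of k] by (auto simp: divide_le_eq)
  have tr: "(\<lambda>k. t k / r k) \<longlonglongrightarrow> 0"
    by (rule real_tendsto_sandwich[OF _ _ tendsto_const t0])
       (use le *(1) r in \<open>auto intro!: always_eventually divide_nonneg_nonneg less_imp_le\<close>)
  have "(\<lambda>k. norm (u k - d) / r k) \<longlonglongrightarrow> 0"
    by (rule real_tendsto_sandwich[OF _ _ tendsto_const n0])
       (use le r in \<open>auto intro!: always_eventually divide_nonneg_nonneg intro: less_imp_le\<close>)
  then have "(\<lambda>k. 2 * (norm (u k - d) / r k)) \<longlonglongrightarrow> 2 * 0" by (intro tendsto_intros)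
  moreover have "2 * (norm (u k - d) / r k) = norm ((2 / r k) *\<^sub>R (u k - d))" for k
    using r[of k] by simp
  ultimately have "(\<lambda>k. norm ((2 / r k) *\<^sub>R (u k - d))) \<longlonglongrightarrow> 0" by (simp only: mult_zero_right)
  then have w: "(\<lambda>k. (2 / r k) *\<^sub>R (u k - d)) \<longlonglongrightarrow> 0" by (simp only: tendsto_norm_zero_iff)
  have "y + t k *\<^sub>R d + ((1/2) * t k * r k) *\<^sub>R ((2 / r k) *\<^sub>R (u k - d)) = y + t k *\<^sub>R u k" for k
    using r[of k] by (simp add: scaleR_diff_right)
  then have "y + t k *\<^sub>R d + ((1/2) * t k * r k) *\<^sub>R ((2 / r k) *\<^sub>R (u k - d)) \<in> S" for k
    using *(4)[of k] by metis
  then show ?thesis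
    by (intro tset_ratioI[OF *(1) r *(2) r0 tr w] always_eventually allI)
qed

text \<open>The midpoint of \<open>z\<close> and \<open>u\<close> has \<open>u\<close> as its unique projection onto \<open>tset_ratio\<close>, so its
  projections onto the rescaled copies of \<open>K\<close> can only accumulate at \<open>u\<close>.\<close>
lemma tset_ratio_proximal_normal_in_dnormal:
  fixes K :: "'a::euclidean_space set"
  assumes "closed K" "u \<in> tset_ratio \<tau> K y v"
    and near: "\<And>u'. u' \<in> tset_ratio \<tau> K y v \<Longrightarrow> norm (z - u) \<le> norm (z - u')"
    and "c \<ge> 0"
  shows "c *\<^sub>R (z - u) \<in> dnormal K y v"
proof -
  obtain t r uk where *: "\<And>k. t k > 0" "\<And>k. r k > 0" "t \<longlonglongrightarrow> 0" "r \<longlonglongrightarrow> 0" "(\<lambda>k. t k / r k) \<longlonglongrightarrow> \<tau>" "uk \<longlonglongrightarrow> u"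
    "\<And>k. y + t k *\<^sub>R v + ((1/2) * t k * r k) *\<^sub>R uk k \<in> K" using assms(2) by (rule tset_ratioE) blast
  define z' where "z' = u + (1/2) *\<^sub>R (z - u)"
  \<comment> \<open>\<open>A k\<close> multiplies distances by \<open>t * r / 2\<close>, so
    projecting \<open>A k z'\<close> onto \<open>K\<close> amounts to projecting \<open>z'\<close>
    onto the rescaled copy of \<open>K\<close>.\<close>
  define A where "A k w = y + t k *\<^sub>R v + ((1/2) * t k * r k) *\<^sub>R w" for k w
  have Adiff: "A k w1 - A k w2 = ((1/2) * t k * r k) *\<^sub>R (w1 - w2)" for k w1 w2
    by (simp add: A_def scaleR_diff_right)
  have "\<exists>w. A k w \<in> K \<and> (\<forall>p\<in>K. norm (A k z' - A k w) \<le> norm (A k z' - p))" for k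
  proof -
    obtain p where p: "p \<in> K" "\<And>q. q \<in> K \<Longrightarrow> dist (A k z') p \<le> dist (A k z') q"
      using distance_attains_inf[OF assms(1), of "A k z'"] *(7) by blast
    have "A k ((1 / ((1/2) * t k * r k)) *\<^sub>R (p - (y + t k *\<^sub>R v))) = p"
      using *(1)[of k] *(2)[of k] unfolding A_def by simp
    then show ?thesis using p by (metis dist_norm)
  qed
  then obtain w where w: "\<And>k. A k (w k) \<in> K"
    "\<And>k p. p \<in> K \<Longrightarrow> norm (A k z' - A k (w k)) \<le> norm (A k z' - p)" by metis
  have le: "norm (z' - w k) \<le> norm (z' - uk k)" for k
  proof -
    have "A k (uk k) \<in> K" using *(7)[of k] by (simp add: A_def)
    then show ?thesis using w(2)[of "A k (uk k)" k] *(1,2)[of k] by (simp add: Adiff)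
  qed
  have uz: "(\<lambda>k. norm (z' - uk k)) \<longlonglongrightarrow> norm (z' - u)" by (intro tendsto_intros *)
  then have "Bseq (\<lambda>k. norm (z' - uk k))" by (intro convergent_imp_Bseq convergentI)
  then obtain B where B: "\<And>k. norm (z' - uk k) \<le> B" by (auto simp: Bseq_def)
  have "norm (w k) \<le> norm z' + B" for k
    using le[of k] B[of k] norm_triangle_ineq4[of z' "z' - w k"] by simp
  then have "bounded (range w)" by (auto simp: bounded_iff)
  then obtain wl s' where s': "strict_mono s'" "(w \<circ> s') \<longlonglongrightarrow> wl" by (rule bounded_convergent_subseq)
  have "wl \<in> tset_ratio \<tau> K y v"
  proof (rule tset_ratioI)
    show "(t \<circ> s') \<longlonglongrightarrow> 0" "(r \<circ> s') \<longlonglongrightarrow> 0" "(\<lambda>k. (t \<circ> s') k / (r \<circ> s') k) \<longlonglongrightarrow> \<tau>"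
      using *(3-5)[THEN LIMSEQ_subseq_LIMSEQ, OF s'(1)] by (simp_all add: o_def)
    have "y + (t \<circ> s') k *\<^sub>R v + ((1/2) * (t \<circ> s') k * (r \<circ> s') k) *\<^sub>R (w \<circ> s') k \<in> K" for k
      using w(1)[of "s' k"] by (simp add: A_def)
    then show "\<forall>\<^sub>F k in sequentially. y + (t \<circ> s') k *\<^sub>R v + ((1/2) * (t \<circ> s') k * (r \<circ> s') k) *\<^sub>R (w \<circ> s') k \<in> K"
      by (rule always_eventually[OF allI])
    show "(w \<circ> s') \<longlonglongrightarrow> wl" by (rule s'(2))
  qed (use * in auto)
  then have n1: "norm (z - u) \<le> norm (z - wl)" by (rule near)
  have "norm (z' - wl) \<le> norm (z' - u)"
  proof (rule LIMSEQ_le)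
    show "(\<lambda>k. norm (z' - (w \<circ> s') k)) \<longlonglongrightarrow> norm (z' - wl)" by (intro tendsto_intros s')
    show "(\<lambda>k. norm (z' - (uk \<circ> s') k)) \<longlonglongrightarrow> norm (z' - u)"
      using LIMSEQ_subseq_LIMSEQ[OF uz s'(1)] by (simp add: o_def)
  qed (use le in auto)
  then have "(norm (z' - wl))\<^sup>2 \<le> (norm (z' - u))\<^sup>2" by (simp add: power_mono)
  moreover have "z' - wl = (1/2) *\<^sub>R (z - u) - (wl - u)" "z' - u = (1/2) *\<^sub>R (z - u)"
    by (simp_all add: z'_def)
  ultimately have n2: "(norm ((1/2) *\<^sub>R (z - u) - (wl - u)))\<^sup>2 \<le> (norm ((1/2) *\<^sub>R (z - u)))\<^sup>2" by simp
  have "(norm (z - u))\<^sup>2 \<le> (norm ((z - u) - (wl - u)))\<^sup>2" using n1 by (simp add: power_mono)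
  then have n3: "2 * ((z - u) \<bullet> (wl - u)) \<le> (wl - u) \<bullet> (wl - u)"
    unfolding power2_norm_eq_inner by (simp only: inner_diff_left[of "z-u" "wl-u"] inner_diff_right[of _ "z-u" "wl-u"] inner_commute[of "wl-u" "z-u"])
  \<comment> \<open>Here \<open>n2\<close> gives
    \<open>(norm (wl - u))\<^sup>2 \<le> (z - u) \<bullet> (wl - u)\<close>, while \<open>n3\<close>
    bounds twice the right side by the left side. Together they force \<open>wl = u\<close>; with
    \<open>z\<close> in place of its midpoint, several nearest points would be possible.\<close>
  have "(wl - u) \<bullet> (wl - u) \<le> (z - u) \<bullet> (wl - u)"
    using n2 unfolding power2_norm_eq_inner
    by (simp only: inner_diff_left[of "_ *\<^sub>R _" "wl-u"] inner_diff_right[of _ "_ *\<^sub>R _" "wl-u"] inner_commute[of "wl-u" "_ *\<^sub>R _"]) simp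
  then have "(wl - u) \<bullet> (wl - u) \<le> 0" using n3 by linarith
  then have "(norm (wl - u))\<^sup>2 \<le> 0" by (simp only: power2_norm_eq_inner)
  then have "wl = u" by simp
  then have wu: "(w \<circ> s') \<longlonglongrightarrow> u" using s' by simp
  show ?thesis unfolding dnormal_def
  proof (intro CollectI exI conjI allI)
    show "(t \<circ> s') \<longlonglongrightarrow> 0" using LIMSEQ_subseq_LIMSEQ[OF *(3) s'(1)] .
    show "(t \<circ> s') k > 0" for k using * by simp
    have "(\<lambda>k. v + ((1/2) * (r \<circ> s') k) *\<^sub>R (w \<circ> s') k) \<longlonglongrightarrow> v + ((1/2) * 0) *\<^sub>R u"
      by (intro tendsto_intros wu LIMSEQ_subseq_LIMSEQ[OF *(4) s'(1)])
    then show "(\<lambda>k. v + ((1/2) * (r \<circ> s') k) *\<^sub>R (w \<circ> s') k) \<longlonglongrightarrow> v" by simp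
    have "(\<lambda>k. (2 * c) *\<^sub>R (z' - (w \<circ> s') k)) \<longlonglongrightarrow> (2 * c) *\<^sub>R (z' - u)"
      by (intro tendsto_intros wu)
    then show "(\<lambda>k. (2 * c) *\<^sub>R (z' - (w \<circ> s') k)) \<longlonglongrightarrow> c *\<^sub>R (z - u)" by (simp add: z'_def)
    fix k
    \<comment> \<open>Differences under \<open>A\<close> carry the factor \<open>t * r / 2\<close>,
      and \<open>z' - u\<close> is half of \<open>z - u\<close>; hence this multiple equals
      \<open>2 * c\<close> times \<open>z' - w\<close>, with limit
      \<open>c *\<^sub>R (z - u)\<close>.\<close>
    have "(4 * c / (t (s' k) * r (s' k))) *\<^sub>R (A (s' k) z' - A (s' k) (w (s' k)))
      \<in> rnormal K (A (s' k) (w (s' k)))"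
      using assms(4) *(1)[of "s' k"] *(2)[of "s' k"]
      by (intro nearest_point_rnormal w divide_nonneg_nonneg) auto
    moreover have "A (s' k) (w (s' k)) = y + (t \<circ> s') k *\<^sub>R (v + ((1/2) * (r \<circ> s') k) *\<^sub>R (w \<circ> s') k)"
      by (simp add: A_def scaleR_add_right)
    moreover have "(4 * c / (t (s' k) * r (s' k))) *\<^sub>R (A (s' k) z' - A (s' k) (w (s' k))) = (2 * c) *\<^sub>R (z' - (w \<circ> s') k)"
      using *(1)[of "s' k"] *(2)[of "s' k"] by (simp add: Adiff)
    ultimately show "(2 * c) *\<^sub>R (z' - (w \<circ> s') k) \<in> rnormal K (y + (t \<circ> s') k *\<^sub>R (v + ((1/2) * (r \<circ> s') k) *\<^sub>R (w \<circ> s') k))"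
      by simp
  qed
qed

subsection \<open>Multipliers for linearly constrained problems\<close>

text \<open>Reads off stationarity of a quadratic function along a line without differentiating
  it.\<close>

lemma quadratic_nonneg_imp_linear_coeff_0:
  fixes L Q :: real
  assumes "\<And>t. 0 \<le> t * L + t\<^sup>2 * Q"
  shows "L = 0"
proof (rule ccontr)
  assume "L \<noteq> 0"
  \<comment> \<open>Since \<open>q\<close> exceeds both 0 and \<open>Q\<close>, the value at
    \<open>t = - L / q\<close> is \<open>L\<^sup>2 * (Q - q) / q\<^sup>2\<close>, which is
    negative.\<close>
  define q where "q = \<bar>Q\<bar> + 1"
  have q: "q > 0" "Q < q" by (auto simp: q_def)
  have "0 \<le> q\<^sup>2 * ((- L / q) * L + (- L / q)\<^sup>2 * Q)"
    using assms[of "- L / q"] by simp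
  also have "\<dots> = L\<^sup>2 * (Q - q)" using q by (simp add: field_simps power2_eq_square)
  also have "\<dots> < 0" using q \<open>L \<noteq> 0\<close> by (simp add: mult_less_0_iff)
  finally show False by simp
qed

lemma norm_add_squared_expand:
  fixes x y :: "'a::real_inner"
  shows "(norm (x + t *\<^sub>R y))\<^sup>2 = (norm x)\<^sup>2 + t * (2 * (x \<bullet> y)) + t\<^sup>2 * (norm y)\<^sup>2"
  unfolding power2_norm_eq_inner
  by (simp add: inner_add_left inner_add_right inner_commute power2_eq_square algebra_simps)

text \<open>A point \<open>(w, u)\<close> with residual \<open>s = norm (G w + b - u)\<close> lies
  within \<open>\<kappa> * s\<close> of a feasible \<open>w'\<close>, where optimality of
  \<open>wb\<close> bounds the objective from below. The penalised function thus dominates a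
  quadratic in \<open>s\<close>, which yields a minimiser and a bound on \<open>i * s\<close>
  independent of \<open>i\<close>.\<close>

lemma quadratic_penalty_minimiser:
  fixes G :: "'a::euclidean_space \<Rightarrow> 'b::euclidean_space"
  assumes "linear G" "closed T" "\<kappa> > 0" "\<epsilon> \<ge> 0"
    and reg: "\<And>w u. u \<in> T \<Longrightarrow> \<exists>w'. G w' + b \<in> T \<and> norm (w - w') \<le> \<kappa> * norm (G w + b - u)"
    and wb: "G wb + b \<in> T"
    and opt: "\<And>w. G w + b \<in> T \<Longrightarrow> 0 \<le> a \<bullet> (w - wb) + (\<epsilon>/2) * (norm (w - wb))\<^sup>2"
    and i: "i \<ge> 4 * \<epsilon> * \<kappa>\<^sup>2 + 4"
  obtains w u where "u \<in> T" "\<And>u'. u' \<in> T \<Longrightarrow> norm (G w + b - u) \<le> norm (G w + b - u')"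
    "i * norm (G w + b - u) \<le> 4 * \<kappa> * norm a"
    "(norm (w - wb))\<^sup>2 \<le> \<kappa> * norm a * norm (G w + b - u)"
    "\<And>h. a \<bullet> h + (i *\<^sub>R (G w + b - u)) \<bullet> G h + 2 * (\<epsilon> + 1) * ((w - wb) \<bullet> h) = 0"
proof -
  interpret G: bounded_linear G using assms(1) by (simp add: linear_conv_bounded_linear)
  \<comment> \<open>Passing from \<open>w'\<close> to \<open>w\<close> turns
    \<open>(\<epsilon>/2) * (norm (w' - wb))\<^sup>2\<close> into at most \<open>\<epsilon> * (norm
    (w - wb))\<^sup>2 + \<epsilon> * \<kappa>\<^sup>2 * s\<^sup>2\<close>. The weight
    \<open>\<epsilon> + 1\<close> absorbs the first term with one square to spare; the threshold on
    \<open>i\<close> lets half of the penalty absorb the second.\<close>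
  define F where "F = (\<lambda>(w, u). a \<bullet> (w - wb) + (i/2) * (norm (G w + b - u))\<^sup>2 + (\<epsilon> + 1) * (norm (w - wb))\<^sup>2)"
  have i4: "i \<ge> 4" using i assms(4) by (smt (verit) mult_nonneg_nonneg zero_le_power2)
  have F_lower: "(i/4) * s\<^sup>2 - norm a * \<kappa> * s + (norm (w - wb))\<^sup>2 \<le> F (w, u)"
    if uT: "u \<in> T" and s: "s = norm (G w + b - u)" for w u s
  proof -
    obtain w' where w': "G w' + b \<in> T" "norm (w - w') \<le> \<kappa> * s" using reg[OF uT] s by blast
    have "- (a \<bullet> (w - w')) \<le> norm a * norm (w - w')"
      using Cauchy_Schwarz_ineq2[of a "w - w'"] by linarith
    also have "\<dots> \<le> norm a * (\<kappa> * s)" using w'(2) by (intro mult_left_mono) auto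
    finally have 1: "- (a \<bullet> (w - w')) \<le> norm a * \<kappa> * s" by simp
    have "norm (w' - wb) \<le> norm (w - wb) + \<kappa> * s"
      using w'(2) norm_triangle_ineq4[of "w - wb" "w - w'"] by simp
    then have "(norm (w' - wb))\<^sup>2 \<le> (norm (w - wb) + \<kappa> * s)\<^sup>2" by (intro power_mono) auto
    also have "\<dots> \<le> 2 * (norm (w - wb))\<^sup>2 + 2 * (\<kappa> * s)\<^sup>2"
      using zero_le_power2[of "norm (w - wb) - \<kappa> * s"] by (simp add: power2_eq_square algebra_simps)
    finally have "(\<epsilon>/2) * (norm (w' - wb))\<^sup>2 \<le> (\<epsilon>/2) * (2 * (norm (w - wb))\<^sup>2 + 2 * (\<kappa> * s)\<^sup>2)"
      using assms(4) by (intro mult_left_mono) auto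
    then have 2: "(\<epsilon>/2) * (norm (w' - wb))\<^sup>2 \<le> \<epsilon> * (norm (w - wb))\<^sup>2 + \<epsilon> * \<kappa>\<^sup>2 * s\<^sup>2"
      by (simp add: power_mult_distrib algebra_simps)
    have 3: "\<epsilon> * \<kappa>\<^sup>2 * s\<^sup>2 \<le> (i/4) * s\<^sup>2" using i by (intro mult_right_mono) auto
    have 4: "0 \<le> a \<bullet> (w' - wb) + (\<epsilon>/2) * (norm (w' - wb))\<^sup>2" using opt w' by blast
    have 5: "a \<bullet> (w - wb) = a \<bullet> (w' - wb) + a \<bullet> (w - w')" by (simp add: inner_diff_right)
    have 6: "F (w, u) = a \<bullet> (w - wb) + 2 * ((i/4) * s\<^sup>2) + (\<epsilon> * (norm (w - wb))\<^sup>2 + (norm (w - wb))\<^sup>2)"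
      unfolding F_def s by (simp add: algebra_simps)
    show ?thesis unfolding 6 5 using 1 2 3 4 by linarith
  qed
  have F0: "F (wb, G wb + b) = 0" by (simp add: F_def)
  \<comment> \<open>Where \<open>F\<close> is nonpositive the lower bound gives
    \<open>(i/4) * s\<^sup>2 \<le> norm a * \<kappa> * s\<close>; dividing by \<open>s\<close>
    bounds the norm of the future multiplier.\<close>
  have sub: "i * s \<le> 4 * \<kappa> * norm a \<and> (norm (w - wb))\<^sup>2 \<le> \<kappa> * norm a * s"
    if "u \<in> T" "s = norm (G w + b - u)" "F (w, u) \<le> 0" for w u s
  proof -
    have *: "(i/4) * s\<^sup>2 + (norm (w - wb))\<^sup>2 \<le> norm a * \<kappa> * s" using F_lower[OF that(1,2)] that(3) by linarith
    then have "(i/4) * s\<^sup>2 \<le> norm a * \<kappa> * s" using zero_le_power2[of "norm (w - wb)"] by linarith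
    then have "s * (i * s) \<le> s * (4 * \<kappa> * norm a)" by (simp add: power2_eq_square mult_ac)
    moreover have "s \<ge> 0" using that by simp
    ultimately have "i * s \<le> 4 * \<kappa> * norm a"
      using assms(3) by (cases "s = 0") (auto simp: mult_le_cancel_left)
    moreover have "0 \<le> (i/4) * s\<^sup>2" using i4 by simp
    ultimately show ?thesis using * by (simp add: mult_ac)
  qed
  have "closed (UNIV \<times> T)" using assms(2) by (intro closed_Times) auto
  moreover have "continuous_on UNIV F"
    unfolding F_def case_prod_unfold
    by (intro continuous_intros G.continuous_on)
  moreover have "(wb, G wb + b) \<in> UNIV \<times> T" using wb by simp
  moreover have "bounded {x \<in> UNIV \<times> T. F x \<le> F (wb, G wb + b)}"
  proof -
    define s0 where "s0 = 4 * \<kappa> * norm a"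
    define R where "R = norm wb + (\<kappa> * norm a * s0 + 1)"
    obtain BG where BG: "\<And>x. norm (G x) \<le> norm x * BG" "BG > 0" using G.pos_bounded by blast
    have "w \<in> cball 0 R \<and> u \<in> cball 0 (R * BG + norm b + s0)" if "u \<in> T" "F (w, u) \<le> 0" for w u
    proof -
      define s where "s = norm (G w + b - u)"
      note sb = sub[OF that(1) s_def that(2)]
      have "s \<ge> 0" by (simp add: s_def)
      then have "s \<le> i * s" using i4 by (simp add: mult_le_cancel_right1)
      then have ss: "s \<le> s0" using sb unfolding s0_def by linarith
      have "(norm (w - wb))\<^sup>2 \<le> \<kappa> * norm a * s0"
        using sb ss assms(3) by (smt (verit) mult_left_mono mult_nonneg_nonneg norm_ge_zero)
      moreover have "norm (w - wb) \<le> (norm (w - wb))\<^sup>2 + 1"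
        using zero_le_power2[of "norm (w - wb) - 1"] norm_ge_zero[of "w - wb"] unfolding power2_diff mult_1_right one_power2 by linarith
      ultimately have "norm (w - wb) \<le> \<kappa> * norm a * s0 + 1" by linarith
      then have wR: "norm w \<le> R" unfolding R_def using norm_triangle_sub[of w wb] by simp
      have "norm u \<le> norm (G w) + norm b + s" unfolding s_def
        using norm_triangle_ineq4[of "G w + b" "G w + b - u"] norm_triangle_ineq[of "G w" b] by simp
      also have "norm (G w) \<le> R * BG" using BG(1)[of w] wR BG(2) by (meson less_imp_le mult_right_mono order_trans)
      finally show ?thesis using wR ss by simp
    qed
    then have "{x \<in> UNIV \<times> T. F x \<le> F (wb, G wb + b)} \<subseteq> cball 0 R \<times> cball 0 (R * BG + norm b + s0)"
      unfolding F0 by auto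
    then show ?thesis by (rule bounded_subset[rotated]) (intro bounded_Times bounded_cball)
  qed
  ultimately obtain x where x: "x \<in> UNIV \<times> T" "\<And>y. y \<in> UNIV \<times> T \<Longrightarrow> F x \<le> F y"
    by (rule continuous_attains_inf_bounded_sublevel) blast
  obtain w u where wu: "x = (w, u)" by (cases x)
  have u: "u \<in> T" using x(1) wu by simp
  have min: "F (w, u) \<le> F (w', u')" if "u' \<in> T" for w' u' using x(2)[of "(w', u')"] that wu by simp
  have "F (w, u) \<le> 0" using min[OF wb, of wb] unfolding F0 .
  note sb = sub[OF u refl this]
  \<comment> \<open>With \<open>w\<close> fixed, minimality makes \<open>u\<close> a nearest point
    of \<open>T\<close>. The next claim fixes \<open>u\<close> instead: stationarity in
    \<open>w\<close>, with the gradient of the penalty acting as multiplier.\<close>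
  have "norm (G w + b - u) \<le> norm (G w + b - u')" if "u' \<in> T" for u'
  proof -
    have "(i/2) * (norm (G w + b - u))\<^sup>2 \<le> (i/2) * (norm (G w + b - u'))\<^sup>2"
      using min[OF that, of w] by (simp add: F_def)
    then have "(norm (G w + b - u))\<^sup>2 \<le> (norm (G w + b - u'))\<^sup>2" using i4 by simp
    then show ?thesis by (rule power2_le_imp_le) simp
  qed
  moreover have "a \<bullet> h + (i *\<^sub>R (G w + b - u)) \<bullet> G h + 2 * (\<epsilon> + 1) * ((w - wb) \<bullet> h) = 0" for h
  proof (rule quadratic_nonneg_imp_linear_coeff_0)
    fix t :: real
    have e: "w + t *\<^sub>R h - wb = (w - wb) + t *\<^sub>R h" "G (w + t *\<^sub>R h) + b - u = (G w + b - u) + t *\<^sub>R G h"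
      by (simp_all add: G.add G.scaleR)
    have "F (w, u) \<le> F (w + t *\<^sub>R h, u)" using min[OF u] .
    then show "0 \<le> t * (a \<bullet> h + (i *\<^sub>R (G w + b - u)) \<bullet> G h + 2 * (\<epsilon> + 1) * ((w - wb) \<bullet> h))
       + t\<^sup>2 * ((i/2) * (norm (G h))\<^sup>2 + (\<epsilon> + 1) * (norm h)\<^sup>2)"
      unfolding F_def prod.case e norm_add_squared_expand inner_add_right[of a "w - wb"]
      by (simp add: algebra_simps)
  qed
  ultimately show ?thesis using that[OF u] sb by blast
qed

text \<open>The penalty weight tends to infinity while the vectors \<open>i (G w + b - u)\<close>
  stay in a fixed ball, so a subsequence converges. The residuals vanish, which drives
  \<open>w\<close> to \<open>wb\<close> and removes the localising term from the limit equation.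
  \<open>P\<close> stands for the directional normals to \<open>K\<close>.\<close>

lemma multiplier_at_minimiser:
  fixes G :: "'a::euclidean_space \<Rightarrow> 'b::euclidean_space"
  assumes "linear G" "closed T" "\<kappa> > 0" "\<epsilon> \<ge> 0"
    and reg: "\<And>w u. u \<in> T \<Longrightarrow> \<exists>w'. G w' + b \<in> T \<and> norm (w - w') \<le> \<kappa> * norm (G w + b - u)"
    and P: "closed P"
    and prox: "\<And>z u c. u \<in> T \<Longrightarrow> (\<And>u'. u' \<in> T \<Longrightarrow> norm (z - u) \<le> norm (z - u')) \<Longrightarrow> c \<ge> 0
        \<Longrightarrow> c *\<^sub>R (z - u) \<in> P"
    and wb: "G wb + b \<in> T"
    and opt: "\<And>w. G w + b \<in> T \<Longrightarrow> 0 \<le> a \<bullet> (w - wb) + (\<epsilon>/2) * (norm (w - wb))\<^sup>2"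
  obtains l where "l \<in> P" "l \<in> lnormal T (G wb + b)" "norm l \<le> 4 * \<kappa> * norm a" "\<And>h. a \<bullet> h + l \<bullet> G h = 0"
proof -
  interpret G: bounded_linear G using assms(1) by (simp add: linear_conv_bounded_linear)
  define i where "i n = 4 * \<epsilon> * \<kappa>\<^sup>2 + 4 + real n" for n
  have ige1: "i n \<ge> real (Suc n)" for n
    unfolding i_def using assms(4) by simp
  have ige2: "i n > 0" for n using ige1[of n] by simp
  note ige = ige1 ige2
  have "\<exists>w u. u \<in> T \<and> (\<forall>u'\<in>T. norm (G w + b - u) \<le> norm (G w + b - u')) \<and>
    i n * norm (G w + b - u) \<le> 4 * \<kappa> * norm a \<and>
    (norm (w - wb))\<^sup>2 \<le> \<kappa> * norm a * norm (G w + b - u) \<and>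
    (\<forall>h. a \<bullet> h + (i n *\<^sub>R (G w + b - u)) \<bullet> G h + 2 * (\<epsilon> + 1) * ((w - wb) \<bullet> h) = 0)" for n
    by (rule quadratic_penalty_minimiser[OF assms(1-5) wb opt, of "i n"]) (auto simp: i_def)
  then obtain w u where *: "\<And>n. u n \<in> T" "\<And>n u'. u' \<in> T \<Longrightarrow> norm (G (w n) + b - u n) \<le> norm (G (w n) + b - u')"
    "\<And>n. i n * norm (G (w n) + b - u n) \<le> 4 * \<kappa> * norm a"
    "\<And>n. (norm (w n - wb))\<^sup>2 \<le> \<kappa> * norm a * norm (G (w n) + b - u n)"
    "\<And>n h. a \<bullet> h + (i n *\<^sub>R (G (w n) + b - u n)) \<bullet> G h + 2 * (\<epsilon> + 1) * ((w n - wb) \<bullet> h) = 0"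
    by metis
  have inv0: "(\<lambda>n. c * inverse (real (Suc n))) \<longlonglongrightarrow> 0" for c
    using tendsto_mult[OF tendsto_const LIMSEQ_inverse_real_of_nat, of c] by simp
  have sle: "norm (G (w n) + b - u n) \<le> (4 * \<kappa> * norm a) * inverse (real (Suc n))" for n
  proof -
    have "real (Suc n) * norm (G (w n) + b - u n) \<le> 4 * \<kappa> * norm a"
      using mult_right_mono[OF ige(1)[of n], of "norm (G (w n) + b - u n)"] *(3)[of n] by simp
    then show ?thesis by (simp add: field_simps)
  qed
  have s0: "(\<lambda>n. norm (G (w n) + b - u n)) \<longlonglongrightarrow> 0"
    by (rule real_tendsto_sandwich[OF _ _ tendsto_const inv0])
       (use sle in \<open>auto intro!: always_eventually simp del: of_nat_Suc\<close>)
  have s00: "(\<lambda>n. \<kappa> * norm a * norm (G (w n) + b - u n)) \<longlonglongrightarrow> 0"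
    using tendsto_mult[OF tendsto_const s0, of "\<kappa> * norm a"] by simp
  have "(\<lambda>n. (norm (w n - wb))\<^sup>2) \<longlonglongrightarrow> 0"
    by (rule real_tendsto_sandwich[OF _ _ tendsto_const s00]) (use * in auto)
  then have w: "w \<longlonglongrightarrow> wb"
    by (simp add: LIM_zero_iff tendsto_norm_zero_iff)
  have "(\<lambda>n. G (w n) + b - (G (w n) + b - u n)) \<longlonglongrightarrow> G wb + b - 0"
    using s0 unfolding tendsto_norm_zero_iff by (intro tendsto_intros G.tendsto w)
  then have u: "u \<longlonglongrightarrow> G wb + b" by simp
  define l where "l n = i n *\<^sub>R (G (w n) + b - u n)" for n
  have lb: "norm (l n) \<le> 4 * \<kappa> * norm a" for n using *(3)[of n] ige(2)[of n] by (simp add: l_def)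
  then have "bounded (range l)" by (auto simp: bounded_iff)
  then obtain L s where s: "strict_mono s" "(l \<circ> s) \<longlonglongrightarrow> L" by (rule bounded_convergent_subseq)
  have "l n \<in> P" for n unfolding l_def by (rule prox) (use * ige in \<open>auto intro: less_imp_le\<close>)
  then have "L \<in> P" using closed_sequentially[OF P _ s(2)] by simp
  moreover have "l n \<in> rnormal T (u n)" for n unfolding l_def
    by (rule nearest_point_rnormal) (use * ige in \<open>auto intro: less_imp_le\<close>)
  then have "L \<in> lnormal T (G wb + b)"
    unfolding lnormal_def using s(2) LIMSEQ_subseq_LIMSEQ[OF u s(1)]
    by (intro CollectI exI[of _ "u \<circ> s"] exI[of _ "l \<circ> s"]) auto
  moreover have "norm L \<le> 4 * \<kappa> * norm a"
    by (rule LIMSEQ_le_const2[OF tendsto_norm[OF s(2)]]) (use lb in auto)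
  moreover have "a \<bullet> h + L \<bullet> G h = 0" for h
  proof -
    have "(\<lambda>n. a \<bullet> h + (l \<circ> s) n \<bullet> G h + 2 * (\<epsilon> + 1) * (((w \<circ> s) n - wb) \<bullet> h))
       \<longlonglongrightarrow> a \<bullet> h + L \<bullet> G h + 2 * (\<epsilon> + 1) * ((wb - wb) \<bullet> h)"
      by (intro tendsto_intros s LIMSEQ_subseq_LIMSEQ[OF w s(1)])
    moreover have "a \<bullet> h + (l \<circ> s) n \<bullet> G h + 2 * (\<epsilon> + 1) * (((w \<circ> s) n - wb) \<bullet> h) = 0" for n
      using *(5)[of h "s n"] by (simp add: l_def)
    ultimately have "(\<lambda>n. 0) \<longlonglongrightarrow> a \<bullet> h + L \<bullet> G h" by simp
    then show ?thesis by (simp add: LIMSEQ_const_iff)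
  qed
  ultimately show ?thesis using that by blast
qed

text \<open>The infimum of \<open>c \<bullet> w\<close> need not be attained; minimising \<open>c \<bullet> w + (\<epsilon>/2) * (norm w)\<^sup>2\<close> instead
  perturbs the multiplier equation by \<open>\<epsilon> *\<^sub>R w\<close>, whose norm is of order \<open>sqrt \<epsilon>\<close>.\<close>
lemma multiplier_bounded_below:
  fixes G :: "'a::euclidean_space \<Rightarrow> 'b::euclidean_space"
  assumes "linear G" "closed T" "\<kappa> > 0"
    and reg: "\<And>w u. u \<in> T \<Longrightarrow> \<exists>w'. G w' + b \<in> T \<and> norm (w - w') \<le> \<kappa> * norm (G w + b - u)"
    and P: "closed P"
    and prox: "\<And>z u c. u \<in> T \<Longrightarrow> (\<And>u'. u' \<in> T \<Longrightarrow> norm (z - u) \<le> norm (z - u')) \<Longrightarrow> c \<ge> 0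
        \<Longrightarrow> c *\<^sub>R (z - u) \<in> P"
    and "T \<noteq> {}"
    and low: "\<And>w. G w + b \<in> T \<Longrightarrow> 0 \<le> c \<bullet> w + \<gamma>"
  obtains l where "l \<in> P" "\<And>h. c \<bullet> h + l \<bullet> G h = 0"
    "\<And>e. e > 0 \<Longrightarrow> \<exists>l' w. G w + b \<in> T \<and> l' \<in> lnormal T (G w + b) \<and> dist l' l < e
        \<and> l' \<bullet> (G w + b) \<le> l \<bullet> b + \<gamma> + e"
proof -
  interpret G: bounded_linear G using assms(1) by (simp add: linear_conv_bounded_linear)
  obtain w0 where w0: "G w0 + b \<in> T" using reg assms(7) by blast
  \<comment> \<open>Comparing \<open>F w\<close> with \<open>F w0\<close>, using \<open>low\<close>
    for \<open>c \<bullet> w\<close> and \<open>\<epsilon> n \<le> 1\<close>, leaves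
    \<open>\<epsilon> n * (norm w)\<^sup>2 \<le> R\<close> with \<open>R\<close> independent of
    \<open>n\<close>.\<close>
  define R where "R = 2 * (\<gamma> + c \<bullet> w0 + (norm w0)\<^sup>2)"
  define \<epsilon> where "\<epsilon> n = inverse (real (Suc n))" for n
  have \<epsilon>: "\<epsilon> n > 0" "\<epsilon> n \<le> 1" for n by (auto simp: \<epsilon>_def divide_simps)
  have \<epsilon>0: "\<epsilon> \<longlonglongrightarrow> 0" unfolding \<epsilon>_def by (rule LIMSEQ_inverse_real_of_nat)
  have "\<exists>w l. G w + b \<in> T \<and> \<epsilon> n * (norm w)\<^sup>2 \<le> R \<and> l \<in> P \<and> l \<in> lnormal T (G w + b)
     \<and> norm l \<le> 4 * \<kappa> * norm (c + \<epsilon> n *\<^sub>R w) \<and> (\<forall>h. (c + \<epsilon> n *\<^sub>R w) \<bullet> h + l \<bullet> G h = 0)" for n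
  proof -
    define F where "F w = c \<bullet> w + (\<epsilon> n/2) * (norm w)\<^sup>2" for w
    have Fb: "\<epsilon> n * (norm w)\<^sup>2 \<le> R" if "G w + b \<in> T" "F w \<le> F w0" for w
    proof -
      have "(\<epsilon> n/2) * (norm w0)\<^sup>2 \<le> 1 * (norm w0)\<^sup>2" using \<epsilon>[of n] by (intro mult_right_mono) auto
      then show ?thesis using low[OF that(1)] that(2) unfolding R_def F_def by simp
    qed
    have cl: "closed {w. G w + b \<in> T}"
      using closed_vimage[OF assms(2), of "\<lambda>w. G w + b"]
      by (simp add: vimage_def continuous_intros G.continuous_on)
    moreover have "continuous_on UNIV F" unfolding F_def by (intro continuous_intros)
    moreover have "w0 \<in> {w. G w + b \<in> T}" using w0 by simp
    moreover have "norm w \<le> R / \<epsilon> n + 1" if "G w + b \<in> T" "F w \<le> F w0" for w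
    proof -
      have "(norm w)\<^sup>2 \<le> R / \<epsilon> n" using Fb[OF that] \<epsilon>[of n] by (simp add: field_simps)
      moreover have "norm w \<le> (norm w)\<^sup>2 + 1"
        using zero_le_power2[of "norm w - 1"] norm_ge_zero[of w] unfolding power2_diff mult_1_right one_power2 by linarith
      ultimately show ?thesis by linarith
    qed
    then have "bounded {w \<in> {w. G w + b \<in> T}. F w \<le> F w0}" by (auto simp: bounded_iff)
    ultimately obtain w where w: "w \<in> {w. G w + b \<in> T}" "\<And>y. y \<in> {w. G w + b \<in> T} \<Longrightarrow> F w \<le> F y"
      by (rule continuous_attains_inf_bounded_sublevel) blast
    \<comment> \<open>Expanding the square about \<open>w\<close> separates the gradient
      \<open>c + \<epsilon> n *\<^sub>R w\<close> from a quadratic remainder, which is the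
      optimality condition that \<open>multiplier_at_minimiser\<close> takes.\<close>
    have "0 \<le> (c + \<epsilon> n *\<^sub>R w) \<bullet> (y - w) + (\<epsilon> n/2) * (norm (y - w))\<^sup>2" if "G y + b \<in> T" for y
    proof -
      have "F w \<le> F (w + 1 *\<^sub>R (y - w))" using w(2) that by simp
      then show ?thesis unfolding F_def norm_add_squared_expand by (simp add: inner_add_right inner_add_left algebra_simps)
    qed
    from multiplier_at_minimiser[OF assms(1-3) less_imp_le[OF \<epsilon>(1)] reg P prox _ this] w(1)
    obtain l where "l \<in> P" "l \<in> lnormal T (G w + b)" "norm l \<le> 4 * \<kappa> * norm (c + \<epsilon> n *\<^sub>R w)"
      "\<And>h. (c + \<epsilon> n *\<^sub>R w) \<bullet> h + l \<bullet> G h = 0" by blast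
    then show ?thesis using Fb[of w] w w0 by (intro exI[of _ w] exI[of _ l]) auto
  qed
  then obtain w l where *: "\<And>n. G (w n) + b \<in> T" "\<And>n. \<epsilon> n * (norm (w n))\<^sup>2 \<le> R" "\<And>n. l n \<in> P"
    "\<And>n. l n \<in> lnormal T (G (w n) + b)" "\<And>n. norm (l n) \<le> 4 * \<kappa> * norm (c + \<epsilon> n *\<^sub>R w n)"
    "\<And>n h. (c + \<epsilon> n *\<^sub>R w n) \<bullet> h + l n \<bullet> G h = 0" by metis
  have le: "(norm (\<epsilon> n *\<^sub>R w n))\<^sup>2 \<le> \<epsilon> n * R" for n
    using mult_left_mono[OF *(2)[of n], of "\<epsilon> n"] \<epsilon>[of n] by (simp add: power_mult_distrib power2_eq_square mult_ac)
  have lim: "(\<lambda>n. \<epsilon> n * R) \<longlonglongrightarrow> 0" using tendsto_mult[OF \<epsilon>0 tendsto_const, of R] by simp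
  have "(\<lambda>n. (norm (\<epsilon> n *\<^sub>R w n))\<^sup>2) \<longlonglongrightarrow> 0"
    by (rule real_tendsto_sandwich[OF _ _ tendsto_const lim])
       (auto intro!: always_eventually le simp del: norm_scaleR)
  then have "(\<lambda>n. norm (\<epsilon> n *\<^sub>R w n)) \<longlonglongrightarrow> 0" by simp
  then have ew: "(\<lambda>n. \<epsilon> n *\<^sub>R w n) \<longlonglongrightarrow> 0" by (simp only: tendsto_norm_zero_iff)
  have "(\<lambda>n. 4 * \<kappa> * norm (c + \<epsilon> n *\<^sub>R w n)) \<longlonglongrightarrow> 4 * \<kappa> * norm (c + 0)" by (intro tendsto_intros ew)
  then have "Bseq (\<lambda>n. 4 * \<kappa> * norm (c + \<epsilon> n *\<^sub>R w n))" by (intro convergent_imp_Bseq) (auto simp: convergent_def)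
  then obtain B where "\<And>n. norm (4 * \<kappa> * norm (c + \<epsilon> n *\<^sub>R w n)) \<le> B" unfolding Bseq_def by blast
  then have "norm (l n) \<le> B" for n using *(5)[of n] by (metis abs_le_D1 order_trans real_norm_def)
  then have "bounded (range l)" by (auto simp: bounded_iff)
  then obtain L s where s: "strict_mono s" "(l \<circ> s) \<longlonglongrightarrow> L" by (rule bounded_convergent_subseq)
  have "L \<in> P" using closed_sequentially[OF P _ s(2)] *(3) by simp
  moreover have "c \<bullet> h + L \<bullet> G h = 0" for h
  proof -
    have "(\<lambda>n. (c + ((\<lambda>n. \<epsilon> n *\<^sub>R w n) \<circ> s) n) \<bullet> h + (l \<circ> s) n \<bullet> G h) \<longlonglongrightarrow> (c + 0) \<bullet> h + L \<bullet> G h"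
      by (intro tendsto_intros s LIMSEQ_subseq_LIMSEQ[OF ew s(1)])
    then have "(\<lambda>n. 0) \<longlonglongrightarrow> c \<bullet> h + L \<bullet> G h" using *(6) by simp
    then show ?thesis by (simp add: LIMSEQ_const_iff)
  qed
  moreover have "\<exists>l' w. G w + b \<in> T \<and> l' \<in> lnormal T (G w + b) \<and> dist l' L < e
        \<and> l' \<bullet> (G w + b) \<le> L \<bullet> b + \<gamma> + e" if "e > 0" for e
  proof -
    have "(\<lambda>n. (l \<circ> s) n \<bullet> b) \<longlonglongrightarrow> L \<bullet> b" by (intro tendsto_intros s)
    then have "\<forall>\<^sub>F n in sequentially. dist ((l \<circ> s) n \<bullet> b) (L \<bullet> b) < e" using that by (rule tendstoD)
    moreover have "\<forall>\<^sub>F n in sequentially. dist ((l \<circ> s) n) L < e" using s(2) that by (rule tendstoD)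
    ultimately have "\<forall>\<^sub>F n in sequentially. dist ((l \<circ> s) n) L < e \<and> dist ((l \<circ> s) n \<bullet> b) (L \<bullet> b) < e"
      by eventually_elim simp
    then obtain n where n: "dist (l (s n)) L < e" "dist (l (s n) \<bullet> b) (L \<bullet> b) < e"
      using eventually_happens'[OF sequentially_bot] by fastforce
    \<comment> \<open>Testing the multiplier equation with \<open>h = w\<close> controls this
      product even if \<open>w\<close> diverges: the regularising term has the favourable sign and
      \<open>low\<close> bounds the rest by \<gamma>.\<close>
    have "l (s n) \<bullet> G (w (s n)) = - (c \<bullet> w (s n)) - \<epsilon> (s n) * (norm (w (s n)))\<^sup>2"
      using *(6)[of "s n" "w (s n)"] by (simp add: inner_add_left power2_norm_eq_inner)
    also have "\<dots> \<le> \<gamma>" using low[OF *(1)[of "s n"]] \<epsilon>(1)[of "s n"]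
      by (smt (verit) mult_nonneg_nonneg zero_le_power2)
    finally have "l (s n) \<bullet> (G (w (s n)) + b) \<le> L \<bullet> b + \<gamma> + e"
      using n(2) by (simp add: inner_add_right dist_real_def)
    then show ?thesis using n(1) *(1,4)[of "s n"] by blast
  qed
  ultimately show ?thesis using that by blast
qed

subsection \<open>Second-order expansions\<close>

lemma C2_D1_has_derivative:
  assumes "C2 g" shows "(g has_derivative D1 g x) (at x)"
  using assms unfolding C2_def D1_def by (meson frechet_derivative_works)

lemma C2_D2_has_derivative:
  assumes "C2 g" shows "((\<lambda>y. D1 g y w) has_derivative (\<lambda>v. D2 g x v w)) (at x)"
  using assms frechet_derivative_works unfolding C2_def D2_def by blast

lemma linear_D1: "C2 g \<Longrightarrow> linear (D1 g x)"
  using C2_D1_has_derivative has_derivative_linear by blast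

lemma linear_D2_left: "C2 g \<Longrightarrow> linear (\<lambda>v. D2 g x v w)"
  using C2_D2_has_derivative has_derivative_linear by blast

text \<open>\<open>D1 g y\<close> is linear for every \<open>y\<close>; differentiating that
  identity in \<open>y\<close> and using uniqueness of derivatives transfers linearity to the second
  slot.\<close>

lemma linear_D2_right:
  assumes "C2 g" shows "linear (D2 g x v)"
proof (rule linearI)
  fix a b c
  have "((\<lambda>y. D1 g y (a + b)) has_derivative (\<lambda>v. D2 g x v a + D2 g x v b)) (at x)"
    using has_derivative_add[OF C2_D2_has_derivative[OF assms, of a x] C2_D2_has_derivative[OF assms, of b x]]
    by (simp add: linear_add[OF linear_D1[OF assms]])
  from has_derivative_unique[OF C2_D2_has_derivative[OF assms] this]
  show "D2 g x v (a + b) = D2 g x v a + D2 g x v b" by meson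
  have "((\<lambda>y. D1 g y (c *\<^sub>R a)) has_derivative (\<lambda>v. c *\<^sub>R D2 g x v a)) (at x)"
    using has_derivative_scaleR_right[OF C2_D2_has_derivative[OF assms, of a x], of c]
    by (simp add: linear_scale[OF linear_D1[OF assms]])
  from has_derivative_unique[OF C2_D2_has_derivative[OF assms] this]
  show "D2 g x v (c *\<^sub>R a) = c *\<^sub>R D2 g x v a" by meson
qed

lemma bounded_bilinear_D2:
  fixes g :: "'a::euclidean_space \<Rightarrow> 'b::euclidean_space"
  assumes "C2 g" shows "bounded_bilinear (D2 g x)"
  using linear_D2_left[OF assms] linear_D2_right[OF assms]
  by (simp add: bilinear_conv_bounded_bilinear[symmetric] bilinear_def)

text \<open>Mean value inequality for \<open>\<phi>\<close> on the unit interval, whose derivative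
  is the first-order error of \<open>D1 g\<close> along the segment.\<close>

lemma C2_second_order_expansion:
  fixes g :: "'a::euclidean_space \<Rightarrow> 'b::euclidean_space"
  assumes "C2 g" "e > 0"
  obtains r where "r > 0" "\<And>h. norm h < r \<Longrightarrow>
    norm (g (x + h) - g x - D1 g x h - (1/2) *\<^sub>R D2 g x h h) \<le> e * (norm h)\<^sup>2"
proof -
  \<comment> \<open>\<open>C2\<close> gives differentiability of \<open>D1 g\<close> evaluated at
    one fixed vector at a time, so the error is estimated on each basis vector; dividing
    \<open>e\<close> by the dimension makes the sum come out to \<open>e\<close>.\<close>
  define N where "N = real (DIM('a))"
  have N: "N > 0" by (simp add: N_def)
  have "\<exists>r>0. \<forall>z. norm z < r \<longrightarrow> norm (D1 g (x + z) i - D1 g x i - D2 g x z i) \<le> (e / N) * norm z" for i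
  proof -
    have "e / N > 0" using assms N by simp
    then obtain r where "r > 0" "\<And>y. norm (y - x) < r \<Longrightarrow> norm (D1 g y i - D1 g x i - D2 g x (y - x) i) \<le> (e / N) * norm (y - x)"
      using C2_D2_has_derivative[OF assms(1), of i x] unfolding has_derivative_at_alt by blast
    from this(1) this(2)[of "x + z" for z] show ?thesis by auto
  qed
  then obtain r where r: "\<And>i. r i > 0" "\<And>i z. norm z < r i \<Longrightarrow> norm (D1 g (x + z) i - D1 g x i - D2 g x z i) \<le> (e / N) * norm z"
    by metis
  define \<rho> where "\<rho> = Min (r ` Basis)"
  have \<rho>: "\<rho> > 0" "\<And>i. i \<in> Basis \<Longrightarrow> \<rho> \<le> r i" using r(1) by (auto simp: \<rho>_def)
  have D1e: "norm (D1 g (x + z) h - D1 g x h - D2 g x z h) \<le> e * norm z * norm h" if "norm z < \<rho>" for z h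
  proof -
    define E where "E i = D1 g (x + z) i - D1 g x i - D2 g x z i" for i
    have linE: "linear E" unfolding E_def
      by (intro linear_compose_sub linear_D1 linear_D2_right assms)
    have "E h = E (\<Sum>i\<in>Basis. (h \<bullet> i) *\<^sub>R i)" by (simp add: euclidean_representation)
    also have "\<dots> = (\<Sum>i\<in>Basis. (h \<bullet> i) *\<^sub>R E i)"
      by (simp add: linear_sum[OF linE] linear_scale[OF linE])
    finally have "norm (E h) \<le> (\<Sum>i\<in>(Basis::'a set). norm h * ((e / N) * norm z))"
    proof (simp only:, intro sum_norm_le)
      fix i :: 'a assume i: "i \<in> Basis"
      have "\<bar>h \<bullet> i\<bar> * norm (E i) \<le> norm h * ((e / N) * norm z)"
        unfolding E_def using i that \<rho>(2)[OF i] by (intro mult_mono Basis_le_norm r(2)) auto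
      then show "norm ((h \<bullet> i) *\<^sub>R E i) \<le> norm h * ((e / N) * norm z)" by simp
    qed
    also have "\<dots> = e * norm z * norm h" using N by (simp add: N_def)
    finally show ?thesis by (simp add: E_def)
  qed
  have "norm (g (x + h) - g x - D1 g x h - (1/2) *\<^sub>R D2 g x h h) \<le> e * (norm h)\<^sup>2" if h: "norm h < \<rho>" for h
  proof -
    define \<phi> where "\<phi> s = g (x + s *\<^sub>R h) - s *\<^sub>R D1 g x h - (s\<^sup>2 / 2) *\<^sub>R D2 g x h h" for s :: real
    have der: "(\<phi> has_derivative (\<lambda>s'. s' *\<^sub>R (D1 g (x + s *\<^sub>R h) h - D1 g x h - s *\<^sub>R D2 g x h h))) (at s within {0..1})" for s
    proof -
      have "((\<lambda>s. x + s *\<^sub>R h) has_derivative (\<lambda>s'. s' *\<^sub>R h)) (at s within {0..1})"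
        by (auto intro!: derivative_eq_intros)
      from has_derivative_compose[OF this C2_D1_has_derivative[OF assms(1)]]
      have "((\<lambda>s. g (x + s *\<^sub>R h)) has_derivative (\<lambda>s'. s' *\<^sub>R D1 g (x + s *\<^sub>R h) h)) (at s within {0..1})"
        by (simp add: linear_scale[OF linear_D1[OF assms(1)]])
      then show ?thesis unfolding \<phi>_def
        by (auto intro!: derivative_eq_intros simp: scaleR_diff_right)
    qed
    have "norm (\<phi> 1 - \<phi> 0) \<le> (e * (norm h)\<^sup>2) * norm (1 - 0 :: real)"
    proof (rule differentiable_bound[OF _ der])
      fix s :: real assume s: "s \<in> {0..1}"
      have sh: "norm (s *\<^sub>R h) \<le> norm h" using s by (simp add: mult_left_le_one_le)
      have "norm (D1 g (x + s *\<^sub>R h) h - D1 g x h - D2 g x (s *\<^sub>R h) h) \<le> e * norm (s *\<^sub>R h) * norm h"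
        using sh h by (intro D1e) linarith
      also have "\<dots> \<le> e * norm h * norm h" using sh assms(2) by (intro mult_right_mono mult_left_mono) auto
      finally have "norm (D1 g (x + s *\<^sub>R h) h - D1 g x h - s *\<^sub>R D2 g x h h) \<le> e * (norm h)\<^sup>2"
        by (simp add: linear_scale[OF linear_D2_left[OF assms(1)]] power2_eq_square mult.assoc)
      then show "onorm (\<lambda>s'. s' *\<^sub>R (D1 g (x + s *\<^sub>R h) h - D1 g x h - s *\<^sub>R D2 g x h h)) \<le> e * (norm h)\<^sup>2"
        using assms(2) by (intro onorm_bound) (simp_all add: mult.commute mult_left_mono)
    qed auto
    moreover have "\<phi> 1 - \<phi> 0 = g (x + h) - g x - D1 g x h - (1/2) *\<^sub>R D2 g x h h" by (simp add: \<phi>_def)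
    ultimately show ?thesis by simp
  qed
  then show ?thesis using that \<rho>(1) by blast
qed

text \<open>The first-order term is taken in the moving direction \<open>u k\<close>: with
  \<open>d\<close> instead, \<open>t * D1 g x (u - d)\<close> need not be negligible against the
  square of \<open>t\<close>.\<close>

lemma C2_second_order_difference_tendsto:
  fixes g :: "'a::euclidean_space \<Rightarrow> 'b::euclidean_space"
  assumes "C2 g" and t: "\<And>k. t k > 0" "t \<longlonglongrightarrow> 0" and u: "u \<longlonglongrightarrow> d"
  shows "(\<lambda>k. (2 / (t k)\<^sup>2) *\<^sub>R (g (x + t k *\<^sub>R u k) - g x - t k *\<^sub>R D1 g x (u k))) \<longlonglongrightarrow> D2 g x d d"
proof -
  interpret D2: bounded_bilinear "D2 g x" by (rule bounded_bilinear_D2[OF assms(1)])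
  define E where "E k = (2 / (t k)\<^sup>2) *\<^sub>R (g (x + t k *\<^sub>R u k) - g x - t k *\<^sub>R D1 g x (u k)) - D2 g x (u k) (u k)" for k
  have "E \<longlonglongrightarrow> 0"
  proof (rule tendstoI)
    fix e :: real assume "e > 0"
    \<comment> \<open>Eventually \<open>C\<close> exceeds \<open>2 * (norm (u k))\<^sup>2\<close>,
      so \<open>e'\<close> leaves a final error of at most \<open>e / 2\<close>.\<close>
    define C where "C = 2 * (norm d + 1)\<^sup>2"
    have "C > 0" unfolding C_def using norm_ge_zero[of d] by (smt (verit) zero_less_power)
    define e' where "e' = e / (2 * C)"
    have "e' > 0" using \<open>e > 0\<close> \<open>C > 0\<close> by (simp add: e'_def)
    then obtain r where r: "r > 0" "\<And>h. norm h < r \<Longrightarrow>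
      norm (g (x + h) - g x - D1 g x h - (1/2) *\<^sub>R D2 g x h h) \<le> e' * (norm h)\<^sup>2"
      using C2_second_order_expansion[OF assms(1)] by blast
    have "(\<lambda>k. norm (t k *\<^sub>R u k)) \<longlonglongrightarrow> norm (0 *\<^sub>R d)" by (intro tendsto_intros t u)
    then have "\<forall>\<^sub>F k in sequentially. norm (t k *\<^sub>R u k) < r" using r(1) by (intro order_tendstoD(2)) auto
    moreover have "\<forall>\<^sub>F k in sequentially. norm (u k) < norm d + 1"
      by (rule order_tendstoD(2)[OF tendsto_norm[OF u]]) simp
    ultimately show "\<forall>\<^sub>F k in sequentially. dist (E k) 0 < e"
    proof eventually_elim
      fix k assume k: "norm (t k *\<^sub>R u k) < r" "norm (u k) < norm d + 1"
      have eq: "E k = (2 / (t k)\<^sup>2) *\<^sub>R (g (x + t k *\<^sub>R u k) - g x - D1 g x (t k *\<^sub>R u k) - (1/2) *\<^sub>R D2 g x (t k *\<^sub>R u k) (t k *\<^sub>R u k))"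
        using t(1)[of k] unfolding E_def
        by (simp add: linear_scale[OF linear_D1[OF assms(1)]] D2.scaleR_left D2.scaleR_right scaleR_diff_right power2_eq_square)
      have "norm (E k) \<le> (2 / (t k)\<^sup>2) * (e' * (norm (t k *\<^sub>R u k))\<^sup>2)"
        unfolding eq norm_scaleR using r(2)[OF k(1)] by (intro mult_mono) auto
      also have "\<dots> = 2 * e' * (norm (u k))\<^sup>2" using t(1)[of k] by (simp add: power_mult_distrib)
      also have "\<dots> \<le> 2 * e' * (norm d + 1)\<^sup>2" using k(2) \<open>e' > 0\<close> by (intro mult_left_mono power_mono) auto
      also have "\<dots> = e / 2" unfolding e'_def using \<open>C > 0\<close> by (simp add: C_def)
      finally show "dist (E k) 0 < e" using \<open>e > 0\<close> by simp
    qed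
  qed
  moreover have "(\<lambda>k. D2 g x (u k) (u k)) \<longlonglongrightarrow> D2 g x d d" by (intro D2.tendsto u)
  ultimately have "(\<lambda>k. E k + D2 g x (u k) (u k)) \<longlonglongrightarrow> 0 + D2 g x d d" by (rule tendsto_add)
  then show ?thesis by (simp add: E_def)
qed

text \<open>Dividing by \<open>t * r / 2\<close> gives the second-order term the weight
  \<open>t / r\<close>, whence the factor \<tau>. The identity is exact, all remainders sitting in
  \<open>ak\<close>, so membership in \<open>K\<close> and signs transfer directly.\<close>

lemma C2_parabolic_curve_expansion:
  fixes g :: "'a::euclidean_space \<Rightarrow> 'b::euclidean_space"
  assumes "C2 g" and tr: "\<And>k. t k > 0" "\<And>k. r k > 0" "t \<longlonglongrightarrow> 0" "r \<longlonglongrightarrow> 0" "(\<lambda>k. t k / r k) \<longlonglongrightarrow> \<tau>"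
    and w: "wk \<longlonglongrightarrow> w"
  obtains ak where "ak \<longlonglongrightarrow> D1 g x w + \<tau> *\<^sub>R D2 g x d d"
    "\<And>k. g (x + t k *\<^sub>R d + ((1/2) * t k * r k) *\<^sub>R wk k) = g x + t k *\<^sub>R D1 g x d + ((1/2) * t k * r k) *\<^sub>R ak k"
proof -
  interpret D1: bounded_linear "D1 g x"
    using linear_D1[OF assms(1)] by (simp add: linear_conv_bounded_linear)
  define u where "u k = d + ((1/2) * r k) *\<^sub>R wk k" for k
  have "u \<longlonglongrightarrow> d + ((1/2) * 0) *\<^sub>R w" unfolding u_def by (intro tendsto_intros tr w)
  then have u: "u \<longlonglongrightarrow> d" by simp
  define ak where "ak k = D1 g x (wk k) + (t k / r k) *\<^sub>R ((2 / (t k)\<^sup>2) *\<^sub>R (g (x + t k *\<^sub>R u k) - g x - t k *\<^sub>R D1 g x (u k)))" for k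
  have "ak \<longlonglongrightarrow> D1 g x w + \<tau> *\<^sub>R D2 g x d d" unfolding ak_def
    by (intro tendsto_intros D1.tendsto w tr C2_second_order_difference_tendsto assms(1) u)
  moreover have "g (x + t k *\<^sub>R d + ((1/2) * t k * r k) *\<^sub>R wk k) = g x + t k *\<^sub>R D1 g x d + ((1/2) * t k * r k) *\<^sub>R ak k" for k
  proof -
    have "t k \<noteq> 0" "r k \<noteq> 0" using tr(1,2)[of k] by auto
    then have "((1/2) * t k * r k) *\<^sub>R ak k = ((1/2) * t k * r k) *\<^sub>R D1 g x (wk k) + (g (x + t k *\<^sub>R u k) - g x - t k *\<^sub>R D1 g x (u k))"
      unfolding ak_def by (simp add: scaleR_add_right power2_eq_square)
    moreover have "t k *\<^sub>R D1 g x (u k) = t k *\<^sub>R D1 g x d + ((1/2) * t k * r k) *\<^sub>R D1 g x (wk k)"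
      by (simp add: u_def D1.add D1.scaleR scaleR_add_right)
    moreover have "x + t k *\<^sub>R u k = x + t k *\<^sub>R d + ((1/2) * t k * r k) *\<^sub>R wk k"
      by (simp add: u_def scaleR_add_right)
    ultimately show ?thesis by simp
  qed
  ultimately show ?thesis using that by blast
qed

section \<open>Curves inside directional neighbourhoods\<close>

text \<open>The cone condition is invariant under positive scaling, so it may be checked at
  \<open>u k\<close>: it is strict at a nonzero limit \<open>d\<close>, and for \<open>d = 0\<close>
  both sides vanish.\<close>

lemma eventually_in_Vdir:
  fixes d :: "'a::euclidean_space"
  assumes t: "\<And>k. t k > 0" "t \<longlonglongrightarrow> 0" and u: "u \<longlonglongrightarrow> d" and "\<rho> > 0" "\<delta> > 0"
  shows "\<forall>\<^sub>F k in sequentially. t k *\<^sub>R u k \<in> Vdir \<rho> \<delta> d"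
proof -
  have "(\<lambda>k. norm (t k *\<^sub>R u k)) \<longlonglongrightarrow> norm (0 *\<^sub>R d)" by (intro tendsto_intros t u)
  then have 1: "\<forall>\<^sub>F k in sequentially. norm (t k *\<^sub>R u k) < \<delta>" using assms(5) by (intro order_tendstoD(2)) auto
  have 2: "\<forall>\<^sub>F k in sequentially. norm (norm d *\<^sub>R u k - norm (u k) *\<^sub>R d) \<le> \<rho> * norm (u k) * norm d"
  proof (cases "d = 0")
    case False
    have "(\<lambda>k. norm (norm d *\<^sub>R u k - norm (u k) *\<^sub>R d) - \<rho> * norm (u k) * norm d) \<longlonglongrightarrow>
      norm (norm d *\<^sub>R d - norm d *\<^sub>R d) - \<rho> * norm d * norm d" by (intro tendsto_intros u)
    moreover have "norm (norm d *\<^sub>R d - norm d *\<^sub>R d) - \<rho> * norm d * norm d < 0" using False assms(4) by simp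
    ultimately have "\<forall>\<^sub>F k in sequentially. norm (norm d *\<^sub>R u k - norm (u k) *\<^sub>R d) - \<rho> * norm (u k) * norm d < 0"
      by (rule order_tendstoD(2))
    then show ?thesis by eventually_elim simp
  qed simp
  from 1 2 show ?thesis
  proof eventually_elim
    fix k assume k: "norm (t k *\<^sub>R u k) < \<delta>" "norm (norm d *\<^sub>R u k - norm (u k) *\<^sub>R d) \<le> \<rho> * norm (u k) * norm d"
    have "norm d *\<^sub>R t k *\<^sub>R u k - norm (t k *\<^sub>R u k) *\<^sub>R d = t k *\<^sub>R (norm d *\<^sub>R u k - norm (u k) *\<^sub>R d)"
      using t(1)[of k] by (simp add: scaleR_diff_right mult.commute)
    then have "norm (norm d *\<^sub>R t k *\<^sub>R u k - norm (t k *\<^sub>R u k) *\<^sub>R d) = t k * norm (norm d *\<^sub>R u k - norm (u k) *\<^sub>R d)"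
      using t(1)[of k] by simp
    also have "\<dots> \<le> t k * (\<rho> * norm (u k) * norm d)" using k(2) t(1)[of k] by (intro mult_left_mono) auto
    also have "\<dots> = \<rho> * norm (t k *\<^sub>R u k) * norm d" using t(1)[of k] by simp
    finally show "t k *\<^sub>R u k \<in> Vdir \<rho> \<delta> d" using k(1) by (simp add: Vdir_def)
  qed
qed

lemma eventually_parabolic_curve_in_Vdir:
  fixes d :: "'a::euclidean_space"
  assumes tr: "\<And>k. t k > 0" "t \<longlonglongrightarrow> 0" "r \<longlonglongrightarrow> 0" and w: "wk \<longlonglongrightarrow> w" and "\<rho> > 0" "\<delta> > 0"
  shows "\<forall>\<^sub>F k in sequentially. (x + t k *\<^sub>R d + ((1/2) * t k * r k) *\<^sub>R wk k) - x \<in> Vdir \<rho> \<delta> d"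
proof -
  have "(\<lambda>k. d + ((1/2) * r k) *\<^sub>R wk k) \<longlonglongrightarrow> d + ((1/2) * 0) *\<^sub>R w" by (intro tendsto_intros tr w)
  then have "(\<lambda>k. d + ((1/2) * r k) *\<^sub>R wk k) \<longlonglongrightarrow> d" by simp
  from eventually_in_Vdir[OF tr(1,2) this assms(5,6)] show ?thesis
    by (simp add: scaleR_add_right mult.assoc mult.left_commute)
qed

subsection \<open>Linearised feasibility and optimality\<close>

lemma tset_ratio_preimage_subset:
  fixes g :: "'a::euclidean_space \<Rightarrow> 'b::euclidean_space"
  assumes "C2 g" "w \<in> tset_ratio \<tau> (g -` K) x d"
  shows "D1 g x w + \<tau> *\<^sub>R D2 g x d d \<in> tset_ratio \<tau> K (g x) (D1 g x d)"
proof -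
  obtain t r wk where *: "\<And>k. t k > 0" "\<And>k. r k > 0" "t \<longlonglongrightarrow> 0" "r \<longlonglongrightarrow> 0" "(\<lambda>k. t k / r k) \<longlonglongrightarrow> \<tau>" "wk \<longlonglongrightarrow> w"
    "\<And>k. x + t k *\<^sub>R d + ((1/2) * t k * r k) *\<^sub>R wk k \<in> g -` K" using assms(2) by (rule tset_ratioE) blast
  obtain ak where ak: "ak \<longlonglongrightarrow> D1 g x w + \<tau> *\<^sub>R D2 g x d d"
    "\<And>k. g (x + t k *\<^sub>R d + ((1/2) * t k * r k) *\<^sub>R wk k) = g x + t k *\<^sub>R D1 g x d + ((1/2) * t k * r k) *\<^sub>R ak k"
    using C2_parabolic_curve_expansion[OF assms(1) *(1-6)] by blast
  show ?thesis
  proof (rule tset_ratioI[OF *(1-5) ak(1)])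
    have "g x + t k *\<^sub>R D1 g x d + ((1/2) * t k * r k) *\<^sub>R ak k \<in> K" for k
      using *(7)[of k] unfolding vimage_eq ak(2) .
    then show "\<forall>\<^sub>F k in sequentially. g x + t k *\<^sub>R D1 g x d + ((1/2) * t k * r k) *\<^sub>R ak k \<in> K"
      by (rule always_eventually[OF allI])
  qed
qed

text \<open>Project the curve with constant coefficient \<open>w\<close> onto the preimage of
  \<open>K\<close>. MSCQ bounds the projection distance by \<kappa> times the distance of the image
  curve to the points of \<open>K\<close> built from \<open>uk\<close>; dividing by
  \<open>s = t * r / 2\<close> keeps the rescaled projections bounded, and a limit of them is
  \<open>w'\<close>.\<close>

lemma MSCQ_dir_tset_ratio_subregular:
  fixes g :: "'a::euclidean_space \<Rightarrow> 'b::euclidean_space"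
  assumes "C2 g" "closed K" "g x \<in> K" "MSCQ_dir g K x d"
  obtains \<kappa> where "\<kappa> > 0" "\<And>\<tau> w u. u \<in> tset_ratio \<tau> K (g x) (D1 g x d) \<Longrightarrow>
    \<exists>w' \<in> tset_ratio \<tau> (g -` K) x d. norm (w - w') \<le> \<kappa> * norm (D1 g x w + \<tau> *\<^sub>R D2 g x d d - u)"
proof -
  obtain \<rho> \<delta> \<kappa> where V: "\<rho> > 0" "\<delta> > 0" "\<kappa> > 0"
    "\<And>y. y - x \<in> Vdir \<rho> \<delta> d \<Longrightarrow> infdist y (g -` K) \<le> \<kappa> * infdist (g y) K"
    using assms(4) unfolding MSCQ_dir_def by blast
  have "continuous_on UNIV g"
    by (intro continuous_at_imp_continuous_on ballI has_derivative_continuous[OF C2_D1_has_derivative[OF assms(1)]])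
  then have C: "closed (g -` K)" "g -` K \<noteq> {}" using assms by (auto intro: closed_vimage)
  have "\<exists>w' \<in> tset_ratio \<tau> (g -` K) x d. norm (w - w') \<le> \<kappa> * norm (D1 g x w + \<tau> *\<^sub>R D2 g x d d - u)"
    if uT: "u \<in> tset_ratio \<tau> K (g x) (D1 g x d)" for \<tau> w u
  proof -
    obtain t r uk where *: "\<And>k. t k > 0" "\<And>k. r k > 0" "t \<longlonglongrightarrow> 0" "r \<longlonglongrightarrow> 0" "(\<lambda>k. t k / r k) \<longlonglongrightarrow> \<tau>" "uk \<longlonglongrightarrow> u"
      "\<And>k. g x + t k *\<^sub>R D1 g x d + ((1/2) * t k * r k) *\<^sub>R uk k \<in> K" using uT by (rule tset_ratioE) blast
    define s where "s k = (1/2) * t k * r k" for k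
    have s: "s k > 0" for k using *(1,2) by (simp add: s_def)
    define X where "X k = x + t k *\<^sub>R d + s k *\<^sub>R w" for k
    obtain ak where ak: "ak \<longlonglongrightarrow> D1 g x w + \<tau> *\<^sub>R D2 g x d d"
      "\<And>k. g (X k) = g x + t k *\<^sub>R D1 g x d + s k *\<^sub>R ak k"
      using C2_parabolic_curve_expansion[OF assms(1) *(1-5) tendsto_const[of w]] unfolding X_def s_def by blast
    have "\<exists>y\<in>g -` K. infdist (X k) (g -` K) = dist (X k) y" for k
      using infdist_attains_inf[OF C, of "X k"] by metis
    then obtain Y where Y: "\<And>k. Y k \<in> g -` K" "\<And>k. infdist (X k) (g -` K) = dist (X k) (Y k)" by metis
    \<comment> \<open>This writes the projection \<open>Y k\<close> on the curve with the same
      \<open>t\<close> and \<open>r\<close>, so limits of \<open>wk\<close> are tangent to the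
      preimage.\<close>
    define wk where "wk k = w + (1 / s k) *\<^sub>R (Y k - X k)" for k
    have Yeq: "x + t k *\<^sub>R d + s k *\<^sub>R wk k = Y k" for k
      using s[of k] by (simp add: wk_def X_def scaleR_add_right)
    have "\<forall>\<^sub>F k in sequentially. X k - x \<in> Vdir \<rho> \<delta> d"
      unfolding X_def s_def
      by (rule eventually_parabolic_curve_in_Vdir[OF *(1,3,4) tendsto_const V(1,2)])
    then have ev: "\<forall>\<^sub>F k in sequentially. norm (w - wk k) \<le> \<kappa> * norm (ak k - uk k)"
    proof eventually_elim
      fix k assume k: "X k - x \<in> Vdir \<rho> \<delta> d"
      have "infdist (g (X k)) K \<le> dist (g (X k)) (g x + t k *\<^sub>R D1 g x d + s k *\<^sub>R uk k)"
        using *(7)[of k] by (intro infdist_le) (simp add: s_def)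
      also have "\<dots> = norm (s k *\<^sub>R (ak k - uk k))" by (simp add: ak(2) dist_norm scaleR_diff_right)
      also have "\<dots> = s k * norm (ak k - uk k)" using s[of k] by simp
      finally have "\<kappa> * infdist (g (X k)) K \<le> \<kappa> * (s k * norm (ak k - uk k))" using V(3) by simp
      then have "norm (X k - Y k) \<le> \<kappa> * (s k * norm (ak k - uk k))"
        using V(4)[OF k] Y(2)[of k] by (simp add: dist_norm)
      moreover have "norm (w - wk k) = norm (X k - Y k) / s k"
        using s[of k] by (simp add: wk_def norm_minus_commute)
      ultimately show "norm (w - wk k) \<le> \<kappa> * norm (ak k - uk k)"
        using s[of k] by (simp add: divide_le_eq mult_ac)
    qed
    then obtain M where M: "\<And>k. k \<ge> M \<Longrightarrow> norm (w - wk k) \<le> \<kappa> * norm (ak k - uk k)"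
      unfolding eventually_sequentially by blast
    have lim: "(\<lambda>k. \<kappa> * norm (ak k - uk k)) \<longlonglongrightarrow> \<kappa> * norm (D1 g x w + \<tau> *\<^sub>R D2 g x d d - u)"
      by (intro tendsto_intros ak *)
    then have "Bseq (\<lambda>k. \<kappa> * norm (ak k - uk k))" by (intro convergent_imp_Bseq convergentI)
    then obtain B where B: "\<And>k. norm (\<kappa> * norm (ak k - uk k)) \<le> B" unfolding Bseq_def by blast
    have "norm (wk (k + M)) \<le> norm w + B" for k
      using M[of "k + M"] B[of "k + M"] norm_triangle_ineq4[of w "w - wk (k + M)"] by simp
    then have "bounded (range (\<lambda>k. wk (k + M)))" by (auto simp: bounded_iff)
    then obtain w' p where p: "strict_mono p" "((\<lambda>k. wk (k + M)) \<circ> p) \<longlonglongrightarrow> w'" by (rule bounded_convergent_subseq)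
    define q where "q k = p k + M" for k
    have q: "strict_mono q" using p(1) by (simp add: strict_mono_def q_def)
    have w': "(wk \<circ> q) \<longlonglongrightarrow> w'" using p(2) by (simp add: o_def q_def)
    have "w' \<in> tset_ratio \<tau> (g -` K) x d"
    proof (rule tset_ratioI)
      show "(t \<circ> q) \<longlonglongrightarrow> 0" "(r \<circ> q) \<longlonglongrightarrow> 0" "(\<lambda>k. (t \<circ> q) k / (r \<circ> q) k) \<longlonglongrightarrow> \<tau>"
        using *(3-5)[THEN LIMSEQ_subseq_LIMSEQ, OF q] by (simp_all add: o_def)
      show "(wk \<circ> q) \<longlonglongrightarrow> w'" by fact
      show "(t \<circ> q) k > 0" "(r \<circ> q) k > 0" for k using * by simp_all
      have "x + (t \<circ> q) k *\<^sub>R d + ((1/2) * (t \<circ> q) k * (r \<circ> q) k) *\<^sub>R (wk \<circ> q) k \<in> g -` K" for k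
        using Yeq[of "q k"] Y(1)[of "q k"] by (simp add: s_def)
      then show "\<forall>\<^sub>F k in sequentially. x + (t \<circ> q) k *\<^sub>R d + ((1/2) * (t \<circ> q) k * (r \<circ> q) k) *\<^sub>R (wk \<circ> q) k \<in> g -` K"
        by (rule always_eventually[OF allI])
    qed
    moreover have "norm (w - w') \<le> \<kappa> * norm (D1 g x w + \<tau> *\<^sub>R D2 g x d d - u)"
    proof (rule LIMSEQ_le)
      show "(\<lambda>k. norm (w - (wk \<circ> q) k)) \<longlonglongrightarrow> norm (w - w')" by (intro tendsto_intros w')
      show "((\<lambda>k. \<kappa> * norm (ak k - uk k)) \<circ> q) \<longlonglongrightarrow> \<kappa> * norm (D1 g x w + \<tau> *\<^sub>R D2 g x d d - u)"
        using lim q by (rule LIMSEQ_subseq_LIMSEQ)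
    qed (use M in \<open>auto simp: q_def\<close>)
    ultimately show ?thesis by blast
  qed
  then show ?thesis using that V(3) by blast
qed

text \<open>Since \<open>D1 f x d = 0\<close>, the change of \<open>f\<close> along the curve is
  \<open>t * r * ak / 2\<close>; directional optimality fixes its sign, which passes to the limit of
  \<open>ak\<close>.\<close>

lemma loc_opt_dir_tset_ratio_nonneg:
  fixes f :: "'a::euclidean_space \<Rightarrow> real"
  assumes "C2 f" "loc_opt_dir f C x d" "D1 f x d = 0" "w \<in> tset_ratio \<tau> C x d"
  shows "0 \<le> D1 f x w + \<tau> * D2 f x d d"
proof -
  obtain \<rho> \<delta> where V: "\<rho> > 0" "\<delta> > 0" "\<And>y. y \<in> C \<Longrightarrow> y - x \<in> Vdir \<rho> \<delta> d \<Longrightarrow> f x \<le> f y"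
    using assms(2) unfolding loc_opt_dir_def by blast
  obtain t r wk where *: "\<And>k. t k > 0" "\<And>k. r k > 0" "t \<longlonglongrightarrow> 0" "r \<longlonglongrightarrow> 0" "(\<lambda>k. t k / r k) \<longlonglongrightarrow> \<tau>" "wk \<longlonglongrightarrow> w"
    "\<And>k. x + t k *\<^sub>R d + ((1/2) * t k * r k) *\<^sub>R wk k \<in> C" using assms(4) by (rule tset_ratioE) blast
  obtain ak where ak: "ak \<longlonglongrightarrow> D1 f x w + \<tau> *\<^sub>R D2 f x d d"
    "\<And>k. f (x + t k *\<^sub>R d + ((1/2) * t k * r k) *\<^sub>R wk k) = f x + t k *\<^sub>R D1 f x d + ((1/2) * t k * r k) *\<^sub>R ak k"
    using C2_parabolic_curve_expansion[OF assms(1) *(1-6)] by blast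
  have "\<forall>\<^sub>F k in sequentially. 0 \<le> ak k"
    using eventually_parabolic_curve_in_Vdir[OF *(1,3,4,6) V(1,2)]
  proof eventually_elim
    fix k assume "(x + t k *\<^sub>R d + ((1/2) * t k * r k) *\<^sub>R wk k) - x \<in> Vdir \<rho> \<delta> d"
    from V(3)[OF *(7) this] have "0 \<le> t k * r k * ak k" unfolding ak(2) assms(3) by simp
    then show "0 \<le> ak k" using mult_pos_pos[OF *(1,2)] by (metis zero_le_mult_iff not_less)
  qed
  then show ?thesis using tendsto_lowerbound[OF ak(1)] by simp
qed

section \<open>Bounds for the lower generalized support function, and the Lagrangian\<close>

lemma lgsupp_le:
  assumes "S \<noteq> {}"
    and "\<And>e. e > 0 \<Longrightarrow> \<exists>l' u. u \<in> A \<and> l' \<in> lnormal S u \<and> dist l' l < e \<and> l' \<bullet> u \<le> q + e"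
  shows "lgsupp S A l \<le> ereal q"
proof (rule ccontr)
  let ?F = "\<lambda>l'. INF u\<in>{u\<in>A. l' \<in> lnormal S u}. ereal (l' \<bullet> u)"
  assume "\<not> ?thesis"
  then have "ereal q < Liminf (nhds l) ?F" using assms(1) by (simp add: lgsupp_def)
  then obtain q' where q': "ereal q < ereal q'" "ereal q' < Liminf (nhds l) ?F"
    using ereal_dense2 by blast
  have "\<forall>\<^sub>F l' in nhds l. ereal q' < ?F l'" using q'(2) by (rule less_LiminfD)
  then obtain e where e: "e > 0" "\<And>l'. dist l' l < e \<Longrightarrow> ereal q' < ?F l'"
    unfolding eventually_nhds_metric by blast
  \<comment> \<open>The first entry keeps \<open>l'\<close> in the ball where the infimum exceeds
    \<open>q'\<close>, the second keeps \<open>l' \<bullet> u\<close> from exceeding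
    \<open>q'\<close>.\<close>
  have "min e (q' - q) > 0" using e q' by simp
  from assms(2)[OF this] obtain l' u where u: "u \<in> A" "l' \<in> lnormal S u" "dist l' l < min e (q' - q)"
    "l' \<bullet> u \<le> q + min e (q' - q)" by blast
  have "?F l' \<le> ereal (l' \<bullet> u)" by (rule INF_lower) (use u in auto)
  moreover have "ereal q' < ?F l'" using e(2) u(3) by simp
  ultimately have "ereal q' < ereal (l' \<bullet> u)" by order
  then show False using u(4) by simp
qed

lemma D1_lagr:
  assumes "C2 f" "C2 g"
  shows "D1 (lagr f g l) x = (\<lambda>h. D1 f x h + l \<bullet> D1 g x h)"
proof -
  have "(lagr f g l has_derivative (\<lambda>h. D1 f x h + l \<bullet> D1 g x h)) (at x)"
    unfolding lagr_def
    by (intro has_derivative_add has_derivative_inner_right C2_D1_has_derivative assms)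
  then show ?thesis unfolding D1_def by (rule frechet_derivative_at[symmetric])
qed

lemma D2_lagr:
  assumes "C2 f" "C2 g"
  shows "D2 (lagr f g l) x v w = D2 f x v w + l \<bullet> D2 g x v w"
proof -
  have "((\<lambda>y. D1 (lagr f g l) y w) has_derivative (\<lambda>v. D2 f x v w + l \<bullet> D2 g x v w)) (at x)"
    unfolding D1_lagr[OF assms]
    by (intro has_derivative_add has_derivative_inner_right C2_D2_has_derivative assms)
  from frechet_derivative_at[OF this] show ?thesis by (metis D2_def)
qed

text \<open>The multiplier is fixed before \<open>A\<close>: the points that witness the liminf
  bound all lie in the image of the tangent set of the preimage, hence in every admissible
  \<open>A\<close>.\<close>

lemma multiplier_tset_ratio:
  fixes f :: "'a::euclidean_space \<Rightarrow> real" and g :: "'a \<Rightarrow> 'b::euclidean_space"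
  assumes "C2 f" and "C2 g" and "closed K" and "g xb \<in> K"
    and "loc_opt_dir f (g -` K) xb d" and "D1 f xb d = 0" and "MSCQ_dir g K xb d"
    and "tset_ratio \<tau> K (g xb) (D1 g xb d) \<noteq> {}"
  obtains l where "l \<in> Mult f g K xb d"
    "\<And>A. (\<lambda>w. D1 g xb w + \<tau> *\<^sub>R D2 g xb d d) ` tset_ratio \<tau> (g -` K) xb d \<subseteq> A \<Longrightarrow>
      lgsupp (tset_ratio \<tau> K (g xb) (D1 g xb d)) A l \<le> ereal (\<tau> * D2 (lagr f g l) xb d d)"
proof -
  let ?T = "tset_ratio \<tau> K (g xb) (D1 g xb d)" and ?b = "\<tau> *\<^sub>R D2 g xb d d"
  obtain \<kappa> where \<kappa>: "\<kappa> > 0" "\<And>w u. u \<in> ?T \<Longrightarrow>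
    \<exists>w' \<in> tset_ratio \<tau> (g -` K) xb d. norm (w - w') \<le> \<kappa> * norm (D1 g xb w + ?b - u)"
    using MSCQ_dir_tset_ratio_subregular[OF assms(2,3,4,7)] by metis
  \<comment> \<open>For \<open>u = D1 g xb w + ?b\<close> the error bound is zero, so the tangent
    vector it provides is \<open>w\<close> itself.\<close>
  have W: "w \<in> tset_ratio \<tau> (g -` K) xb d" if "D1 g xb w + ?b \<in> ?T" for w
    using \<kappa>(2)[OF that, of w] by auto
  define c where "c = adjoint (D1 f xb) 1"
  have c: "c \<bullet> h = D1 f xb h" for h
    using adjoint_works[OF linear_D1[OF assms(1), of xb], of h 1] by (simp add: c_def inner_commute)
  have reg: "\<exists>w'. D1 g xb w' + ?b \<in> ?T \<and> norm (w - w') \<le> \<kappa> * norm (D1 g xb w + ?b - u)" if "u \<in> ?T" for w u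
    using \<kappa>(2)[OF that] tset_ratio_preimage_subset[OF assms(2)] by blast
  have low: "0 \<le> c \<bullet> w + \<tau> * D2 f xb d d" if "D1 g xb w + ?b \<in> ?T" for w
    unfolding c using loc_opt_dir_tset_ratio_nonneg[OF assms(1,5,6) W[OF that]] .
  obtain l where l: "l \<in> dnormal K (g xb) (D1 g xb d)" "\<And>h. c \<bullet> h + l \<bullet> D1 g xb h = 0"
    "\<And>e. e > 0 \<Longrightarrow> \<exists>l' w. D1 g xb w + ?b \<in> ?T \<and> l' \<in> lnormal ?T (D1 g xb w + ?b) \<and> dist l' l < e
        \<and> l' \<bullet> (D1 g xb w + ?b) \<le> l \<bullet> ?b + \<tau> * D2 f xb d d + e"
    by (rule multiplier_bounded_below[OF linear_D1[OF assms(2)] closed_tset_ratio \<kappa>(1) reg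
          closed_dnormal tset_ratio_proximal_normal_in_dnormal[OF assms(3)] assms(8) low]) blast+
  have "l \<in> Mult f g K xb d"
    using l(1,2) by (simp add: Mult_def D1_lagr[OF assms(1,2)] c)
  moreover have "lgsupp ?T A l \<le> ereal (\<tau> * D2 (lagr f g l) xb d d)"
    if "(\<lambda>w. D1 g xb w + ?b) ` tset_ratio \<tau> (g -` K) xb d \<subseteq> A" for A
  proof (rule lgsupp_le[OF assms(8)])
    fix e :: real assume "e > 0"
    from l(3)[OF this] obtain l' w where w: "D1 g xb w + ?b \<in> ?T" "l' \<in> lnormal ?T (D1 g xb w + ?b)" "dist l' l < e"
        "l' \<bullet> (D1 g xb w + ?b) \<le> l \<bullet> ?b + \<tau> * D2 f xb d d + e" by blast
    have "D1 g xb w + ?b \<in> A" using that W[OF w(1)] by blast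
    \<comment> \<open>The curvature of \<open>g\<close> enters through the offset of the constraint
      and that of \<open>f\<close> through the lower bound on the objective; they combine to the
      Hessian of the Lagrangian.\<close>
    moreover have "l \<bullet> ?b + \<tau> * D2 f xb d d = \<tau> * D2 (lagr f g l) xb d d"
      by (simp add: D2_lagr[OF assms(1,2)] algebra_simps)
    ultimately show "\<exists>l' u. u \<in> A \<and> l' \<in> lnormal ?T u \<and> dist l' l < e \<and> l' \<bullet> u \<le> \<tau> * D2 (lagr f g l) xb d d + e"
      using w by (intro exI[of _ l'] exI[of _ "D1 g xb w + ?b"]) simp
  qed
  ultimately show ?thesis using that by blast
qed

theorem theorem4p7:
  fixes f :: "'a::euclidean_space \<Rightarrow> real" and g :: "'a \<Rightarrow> 'b::euclidean_space"
    and K :: "'b set" and xb d :: 'a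
  assumes "C2 f" and "C2 g" and "closed K"
    and "g xb \<in> K"
    and "d \<in> tcone (g -` K) xb"
    and "loc_opt_dir f (g -` K) xb d"
    and "D1 f xb d = 0"
    and "MSCQ_dir g K xb d"
  shows "(\<exists>l\<in>Mult f g K xb d.
            (\<forall>A. D1 g xb ` tset2a (g -` K) xb d \<subseteq> A \<longrightarrow>
                 lgsupp (tset2a K (g xb) (D1 g xb d)) A l \<le> 0) \<and>
            lgsupp (tset2a K (g xb) (D1 g xb d)) UNIV l \<le> 0)
       \<and> (tset2 K (g xb) (D1 g xb d) \<noteq> {} \<longrightarrow>
          (\<exists>l\<in>Mult f g K xb d.
            (\<forall>B. (\<lambda>w. D1 g xb w + D2 g xb d d) ` tset2 (g -` K) xb d \<subseteq> B \<longrightarrow>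
                 ereal (D2 (lagr f g l) xb d d) - lgsupp (tset2 K (g xb) (D1 g xb d)) B l \<ge> 0) \<and>
            ereal (D2 (lagr f g l) xb d d) - lgsupp (tset2 K (g xb) (D1 g xb d)) UNIV l \<ge> 0))"
proof (intro conjI impI)
  have "tset_ratio 0 K (g xb) (D1 g xb d) \<noteq> {}"
    using tset_ratio_preimage_subset[OF assms(2) zero_in_tset_ratio_0[OF assms(5)]] by auto
  from multiplier_tset_ratio[OF assms(1-4,6-8) this]
  obtain l where l: "l \<in> Mult f g K xb d"
    "\<And>A. D1 g xb ` tset_ratio 0 (g -` K) xb d \<subseteq> A \<Longrightarrow>
      lgsupp (tset_ratio 0 K (g xb) (D1 g xb d)) A l \<le> 0"
    by (auto simp: zero_ereal_def)
  then show "\<exists>l\<in>Mult f g K xb d.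
            (\<forall>A. D1 g xb ` tset2a (g -` K) xb d \<subseteq> A \<longrightarrow>
                 lgsupp (tset2a K (g xb) (D1 g xb d)) A l \<le> 0) \<and>
            lgsupp (tset2a K (g xb) (D1 g xb d)) UNIV l \<le> 0"
    unfolding tset2a_eq_tset_ratio by blast
next
  assume "tset2 K (g xb) (D1 g xb d) \<noteq> {}"
  from multiplier_tset_ratio[OF assms(1-4,6-8) this[unfolded tset2_eq_tset_ratio]]
  obtain l where l: "l \<in> Mult f g K xb d"
    "\<And>A. (\<lambda>w. D1 g xb w + D2 g xb d d) ` tset_ratio 1 (g -` K) xb d \<subseteq> A \<Longrightarrow>
      lgsupp (tset_ratio 1 K (g xb) (D1 g xb d)) A l \<le> ereal (D2 (lagr f g l) xb d d)"
    by auto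
  \<comment> \<open>For \<open>q\<close> equal to -\<infinity> the difference is \<infinity>; the
    value \<infinity> is excluded by the bound on \<open>q\<close>.\<close>
  have "0 \<le> ereal p - q" if "q \<le> ereal p" for p q using that by (cases q) auto
  with l show "\<exists>l\<in>Mult f g K xb d.
            (\<forall>B. (\<lambda>w. D1 g xb w + D2 g xb d d) ` tset2 (g -` K) xb d \<subseteq> B \<longrightarrow>
                 ereal (D2 (lagr f g l) xb d d) - lgsupp (tset2 K (g xb) (D1 g xb d)) B l \<ge> 0) \<and>
            ereal (D2 (lagr f g l) xb d d) - lgsupp (tset2 K (g xb) (D1 g xb d)) UNIV l \<ge> 0"
    unfolding tset2_eq_tset_ratio by blast
qed

end
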